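(* Let $X\subseteq Reg$ be a class of regular choice functions and let $\Lambda$ be a formal system with $\mathsf{Ax}(\Lambda)\subseteq Taut(X)$ and whose inference rules are exactly Modus Ponens, the Generalization Rule and $SV$. Then ${\rm RFOLS}(X,\Lambda)$ is sound: for every set $\Sigma$ of restricted sentences of $L_s$ and every restricted sentence $\varphi$ of $L_s$, $\Sigma\vdash_\Lambda\varphi$ implies $\Sigma\models^2_X\varphi$. In particular ${\rm RFOLS}(Reg,\Lambda_1)$, ${\rm RFOLS}(Reg^*,\Lambda_2)$ and ${\rm RFOLS}(Dec,\Lambda_3)$ are sound.
   Context: $L$ is a first-order language (logical symbols $\wedge,\neg,\forall,=$; others abbreviations), $L_s=L\cup\{|\}$ with $|$ a new binary connective. For an $L$-structure $\mathcal M=\langle M,\dots\rangle$, $L(M)$ is $L$ plus a constant for each element of $M$. Basic formulas of $L_s(M)$: smallest set containing all formulas of $L(M)$ and closed under $\wedge,\vee,\rightarrow,\leftrightarrow,\neg,|$ (not quantifiers); restricted formulas: smallest set containing the basic formulas and closed under $\wedge,\vee,\rightarrow,\leftrightarrow,\neg,\forall,\exists$ (not $|$); sentences are those without free variables (same definitions for $L_s$). A choice function for $\mathcal M$ is a map $f$ on unordered pairs of sentences of $L(M)$ with $f(\alpha,\beta)\in\{\alpha,\beta\}$, $f(\alpha,\alpha)=\alpha$. Collapse on basic sentences: $\overline f(\alpha)=\alpha$ for $L(M)$-sentences, $\overline f$ commutes with $\wedge,\neg$, $\overline f(\varphi|\psi)=f(\overline f(\varphi),\overline f(\psi))$. Truth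 $\langle\mathcal M,f\rangle\models^2_s\varphi$ on restricted sentences: classical $\alpha$ iff $\mathcal M\models\alpha$; $\wedge,\neg$ as usual; $\varphi|\psi$ iff $\mathcal M\models f(\overline f(\varphi),\overline f(\psi))$; $\forall v\varphi(v)$ iff $\langle\mathcal M,f\rangle\models^2_s\varphi(x)$ for all $x\in M$. $\sim$ is first-order logical equivalence. $f$ is regular if $\alpha\sim\alpha'$ implies $f(\alpha,\beta)\sim f(\alpha',\beta)$ for all sentences $\alpha,\alpha',\beta$ of $L(M)$; associative if $f(f(\alpha,\beta),\gamma)=f(\alpha,f(\beta,\gamma))$. $Reg$ = regular choice functions; $Reg^*$ = regular and associative ones. $Dec$ = choice functions of the form $f(\alpha,\beta)=\min_<(\alpha,\beta)$ for a total ordering $<$ of the sentences of $L(M)$ which is regular (if $\alpha\not\sim\beta$ and $\alpha<\beta$ then every element of the $\sim$-class of $\alpha$ is below every element of the $\sim$-class of $\beta$) and $\neg$-decreasing (if $\alpha\not\sim\beta$ then $\alpha<\beta\Leftrightarrow\neg\beta<\neg\alpha$). $\Sigma\models^2_X\varphi$: for all $\mathcal M$ and all $f\in X$ for $\mathcal M$, if $\langle\mathcal M,f\rangle$ satisfies all of $\Sigma$ it satisfies $\varphi$; $Taut(X)=\{\varphi:\emptyset\models^2_X\varphi\}$. $\Sigma\vdash_\Lambda\varphi$ is Hilbert-style provability with all formulas restricted. $\Lambda_0$: axioms are restricted instances of the three propositional schemes $\varphi\rightarrow(\psi\rightarrow\varphi)$, $(\varphi\rightarrow(\psi\rightarrow\sigma))\rightarrow((\varphi\rightarrow\psi)\rightarrow(\varphi\rightarrow\sigma))$,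 $(\neg\varphi\rightarrow\neg\psi)\rightarrow((\neg\varphi\rightarrow\psi)\rightarrow\varphi)$, universal instantiation $\forall v\varphi(v)\rightarrow\varphi(t)$ ($t$ closed), $\forall v(\varphi\rightarrow\psi(v))\rightarrow(\varphi\rightarrow\forall v\psi(v))$ ($v$ not free in $\varphi$), the equality axioms, and $S_1$: $\varphi\wedge\psi\rightarrow\varphi|\psi$, $S_2$: $\varphi|\psi\rightarrow\varphi\vee\psi$, $S_3$: $\varphi|\psi\rightarrow\psi|\varphi$; rules Modus Ponens and Generalization. Rule $SV$: for basic formulas $\varphi,\psi,\sigma$, if $\vdash_{\Lambda_0}\varphi\leftrightarrow\psi$, infer $\varphi|\sigma\leftrightarrow\psi|\sigma$. $\Lambda_1$ = $\Lambda_0$ plus rule $SV$; $\Lambda_2$ = $\Lambda_1$ plus axiom scheme $S_4$: $(\varphi|\psi)|\sigma\rightarrow\varphi|(\psi|\sigma)$; $\Lambda_3$ = $\Lambda_2$ plus $S_5$: $\varphi\wedge\neg\psi\rightarrow(\varphi|\psi\leftrightarrow\neg\varphi|\neg\psi)$. ${\rm RFOLS}(X,\Lambda)$ is the logic with consequence $\models^2_X$ and provability $\vdash_\Lambda$.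
   Formalization: For Λ1, Λ2, Λ3 soundness is proved when L has no constants (else universal instantiation fails for some f in Dec); with constants, only for f not separating closed terms from names of their values. Equality axioms are taken only for formulas of L without |. *)

theory Defs
  imports Main "HOL-Library.Uprod"
begin

section \<open>Syntax\<close>

text \<open>A language is given by its function and relation symbols, each paired with its arity;
  constants are the function symbols of arity 0. Equality is logical.\<close>

record ('f, 'p) lang =
  funs :: "('f \<times> nat) set"
  rels :: "('p \<times> nat) set"

text \<open>\<open>Name x\<close> is the constant for the element \<open>x\<close> in \<open>L(M)\<close>. \<open>Super\<close> is the connective \<open>|\<close>.\<close>

datatype ('f, 'a) tm = Var nat | Name 'a | Fn 'f "('f, 'a) tm list"

datatype ('f, 'p, 'a) fm =
    Eq "('f, 'a) tm" "('f, 'a) tm"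
  | Rel 'p "('f, 'a) tm list"
  | Neg "('f, 'p, 'a) fm"
  | And "('f, 'p, 'a) fm" "('f, 'p, 'a) fm"
  | Forall nat "('f, 'p, 'a) fm"
  | Super "('f, 'p, 'a) fm" "('f, 'p, 'a) fm"

definition Imp :: "('f, 'p, 'a) fm \<Rightarrow> ('f, 'p, 'a) fm \<Rightarrow> ('f, 'p, 'a) fm" where
  "Imp \<phi> \<psi> = Neg (And \<phi> (Neg \<psi>))"

definition Or :: "('f, 'p, 'a) fm \<Rightarrow> ('f, 'p, 'a) fm \<Rightarrow> ('f, 'p, 'a) fm" where
  "Or \<phi> \<psi> = Neg (And (Neg \<phi>) (Neg \<psi>))"

definition Iff :: "('f, 'p, 'a) fm \<Rightarrow> ('f, 'p, 'a) fm \<Rightarrow> ('f, 'p, 'a) fm" where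
  "Iff \<phi> \<psi> = And (Imp \<phi> \<psi>) (Imp \<psi> \<phi>)"

primrec fvt :: "('f, 'a) tm \<Rightarrow> nat set" where
  "fvt (Var v) = {v}"
| "fvt (Name a) = {}"
| "fvt (Fn g ts) = \<Union> (set (map fvt ts))"

primrec fv :: "('f, 'p, 'a) fm \<Rightarrow> nat set" where
  "fv (Eq s t) = fvt s \<union> fvt t"
| "fv (Rel p ts) = \<Union> (set (map fvt ts))"
| "fv (Neg \<phi>) = fv \<phi>"
| "fv (And \<phi> \<psi>) = fv \<phi> \<union> fv \<psi>"
| "fv (Forall v \<phi>) = fv \<phi> - {v}"
| "fv (Super \<phi> \<psi>) = fv \<phi> \<union> fv \<psi>"

text \<open>Simultaneous substitution for the free variables. Bound variables are not renamed;
  substituted terms are closed, or else \<open>free_for\<close> is required.\<close>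

primrec substt :: "(nat \<Rightarrow> ('f, 'a) tm) \<Rightarrow> ('f, 'a) tm \<Rightarrow> ('f, 'a) tm" where
  "substt \<sigma> (Var v) = \<sigma> v"
| "substt \<sigma> (Name a) = Name a"
| "substt \<sigma> (Fn g ts) = Fn g (map (substt \<sigma>) ts)"

primrec subst :: "(nat \<Rightarrow> ('f, 'a) tm) \<Rightarrow> ('f, 'p, 'a) fm \<Rightarrow> ('f, 'p, 'a) fm" where
  "subst \<sigma> (Eq s t) = Eq (substt \<sigma> s) (substt \<sigma> t)"
| "subst \<sigma> (Rel p ts) = Rel p (map (substt \<sigma>) ts)"
| "subst \<sigma> (Neg \<phi>) = Neg (subst \<sigma> \<phi>)"
| "subst \<sigma> (And \<phi> \<psi>) = And (subst \<sigma> \<phi>) (subst \<sigma> \<psi>)"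
| "subst \<sigma> (Forall v \<phi>) = Forall v (subst (\<sigma>(v := Var v)) \<phi>)"
| "subst \<sigma> (Super \<phi> \<psi>) = Super (subst \<sigma> \<phi>) (subst \<sigma> \<psi>)"

abbreviation subst1 :: "nat \<Rightarrow> ('f, 'a) tm \<Rightarrow> ('f, 'p, 'a) fm \<Rightarrow> ('f, 'p, 'a) fm" where
  "subst1 v t \<equiv> subst (Var(v := t))"

primrec free_for :: "('f, 'a) tm \<Rightarrow> nat \<Rightarrow> ('f, 'p, 'a) fm \<Rightarrow> bool" where
  "free_for t v (Eq r s) \<longleftrightarrow> True"
| "free_for t v (Rel p ts) \<longleftrightarrow> True"
| "free_for t v (Neg \<phi>) \<longleftrightarrow> free_for t v \<phi>"
| "free_for t v (And \<phi> \<psi>) \<longleftrightarrow> free_for t v \<phi> \<and> free_for t v \<psi>"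
| "free_for t v (Forall w \<phi>) \<longleftrightarrow> v \<notin> fv (Forall w \<phi>) \<or> (w \<notin> fvt t \<and> free_for t v \<phi>)"
| "free_for t v (Super \<phi> \<psi>) \<longleftrightarrow> free_for t v \<phi> \<and> free_for t v \<psi>"

text \<open>\<open>Terms L A\<close>, \<open>Fml L A\<close>, \<open>Basic L A\<close> and \<open>Restricted L A\<close> are the terms of \<open>L(A)\<close>, the
  formulas of \<open>L(A)\<close> and the basic and restricted formulas of \<open>L\<^sub>s(A)\<close>, where \<open>A\<close> is the set of
  named elements. \<open>A = {}\<close> gives \<open>L\<close> and \<open>L\<^sub>s\<close> themselves. Closure under the remaining connectives
  and the existential quantifier follows, as these are abbreviations.\<close>

inductive_set Terms :: "('f, 'p) lang \<Rightarrow> 'a set \<Rightarrow> ('f, 'a) tm set"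
  for L :: "('f, 'p) lang" and A :: "'a set" where
  "Var v \<in> Terms L A"
| "a \<in> A \<Longrightarrow> Name a \<in> Terms L A"
| "(g, length ts) \<in> funs L \<Longrightarrow> \<forall>t \<in> set ts. t \<in> Terms L A \<Longrightarrow> Fn g ts \<in> Terms L A"

inductive_set Fml :: "('f, 'p) lang \<Rightarrow> 'a set \<Rightarrow> ('f, 'p, 'a) fm set"
  for L :: "('f, 'p) lang" and A :: "'a set" where
  "s \<in> Terms L A \<Longrightarrow> t \<in> Terms L A \<Longrightarrow> Eq s t \<in> Fml L A"
| "(p, length ts) \<in> rels L \<Longrightarrow> set ts \<subseteq> Terms L A \<Longrightarrow> Rel p ts \<in> Fml L A"
| "\<phi> \<in> Fml L A \<Longrightarrow> Neg \<phi> \<in> Fml L A"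
| "\<phi> \<in> Fml L A \<Longrightarrow> \<psi> \<in> Fml L A \<Longrightarrow> And \<phi> \<psi> \<in> Fml L A"
| "\<phi> \<in> Fml L A \<Longrightarrow> Forall v \<phi> \<in> Fml L A"

inductive_set Basic :: "('f, 'p) lang \<Rightarrow> 'a set \<Rightarrow> ('f, 'p, 'a) fm set"
  for L :: "('f, 'p) lang" and A :: "'a set" where
  "\<phi> \<in> Fml L A \<Longrightarrow> \<phi> \<in> Basic L A"
| "\<phi> \<in> Basic L A \<Longrightarrow> Neg \<phi> \<in> Basic L A"
| "\<phi> \<in> Basic L A \<Longrightarrow> \<psi> \<in> Basic L A \<Longrightarrow> And \<phi> \<psi> \<in> Basic L A"
| "\<phi> \<in> Basic L A \<Longrightarrow> \<psi> \<in> Basic L A \<Longrightarrow> Super \<phi> \<psi> \<in> Basic L A"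

inductive_set Restricted :: "('f, 'p) lang \<Rightarrow> 'a set \<Rightarrow> ('f, 'p, 'a) fm set"
  for L :: "('f, 'p) lang" and A :: "'a set" where
  "\<phi> \<in> Basic L A \<Longrightarrow> \<phi> \<in> Restricted L A"
| "\<phi> \<in> Restricted L A \<Longrightarrow> Neg \<phi> \<in> Restricted L A"
| "\<phi> \<in> Restricted L A \<Longrightarrow> \<psi> \<in> Restricted L A \<Longrightarrow> And \<phi> \<psi> \<in> Restricted L A"
| "\<phi> \<in> Restricted L A \<Longrightarrow> Forall v \<phi> \<in> Restricted L A"

definition Sen :: "('f, 'p) lang \<Rightarrow> 'a set \<Rightarrow> ('f, 'p, 'a) fm set" where
  "Sen L A = {\<alpha> \<in> Fml L A. fv \<alpha> = {}}"


section \<open>First-order semantics\<close>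

record ('f, 'p, 'd) model =
  univ :: "'d set"
  fint :: "'f \<Rightarrow> 'd list \<Rightarrow> 'd"
  rint :: "'p \<Rightarrow> 'd list \<Rightarrow> bool"

definition is_structure :: "('f, 'p) lang \<Rightarrow> ('f, 'p, 'd) model \<Rightarrow> bool" where
  "is_structure L N \<longleftrightarrow> univ N \<noteq> {} \<and>
     (\<forall>g ds. (g, length ds) \<in> funs L \<longrightarrow> set ds \<subseteq> univ N \<longrightarrow> fint N g ds \<in> univ N)"

text \<open>In an \<open>L(A)\<close>-structure, \<open>h\<close> interprets the names of the elements of \<open>A\<close>.\<close>

primrec val :: "('f, 'p, 'd) model \<Rightarrow> ('a \<Rightarrow> 'd) \<Rightarrow> (nat \<Rightarrow> 'd) \<Rightarrow> ('f, 'a) tm \<Rightarrow> 'd" where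
  "val N h e (Var v) = e v"
| "val N h e (Name a) = h a"
| "val N h e (Fn g ts) = fint N g (map (val N h e) ts)"

text \<open>\<open>sat\<close> is only used for formulas without \<open>Super\<close>; the last equation is a dummy.\<close>

primrec sat :: "('f, 'p, 'd) model \<Rightarrow> ('a \<Rightarrow> 'd) \<Rightarrow> (nat \<Rightarrow> 'd) \<Rightarrow> ('f, 'p, 'a) fm \<Rightarrow> bool" where
  "sat N h e (Eq s t) \<longleftrightarrow> val N h e s = val N h e t"
| "sat N h e (Rel p ts) \<longleftrightarrow> rint N p (map (val N h e) ts)"
| "sat N h e (Neg \<phi>) \<longleftrightarrow> \<not> sat N h e \<phi>"
| "sat N h e (And \<phi> \<psi>) \<longleftrightarrow> sat N h e \<phi> \<and> sat N h e \<psi>"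
| "sat N h e (Forall v \<phi>) \<longleftrightarrow> (\<forall>d \<in> univ N. sat N h (e(v := d)) \<phi>)"
| "sat N h e (Super \<phi> \<psi>) \<longleftrightarrow> undefined"

definition models :: "('f, 'p, 'd) model \<Rightarrow> ('a \<Rightarrow> 'd) \<Rightarrow> ('f, 'p, 'a) fm \<Rightarrow> bool" where
  "models N h \<alpha> \<longleftrightarrow> (\<forall>e. (\<forall>v. e v \<in> univ N) \<longrightarrow> sat N h e \<alpha>)"

text \<open>Truth of an \<open>L(M)\<close>-sentence in \<open>M\<close>: every element names itself.\<close>

abbreviation true_in :: "('f, 'p, 'a) model \<Rightarrow> ('f, 'p, 'a) fm \<Rightarrow> bool" where
  "true_in M \<equiv> models M id"

text \<open>Equivalence of \<open>L(A)\<close>-sentences over all \<open>L(A)\<close>-structures satisfying \<open>T\<close>, and logical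
  equivalence. A formula cannot quantify over types, so the structures have their universes in
  \<open>'a + nat\<close>. This loses nothing: by Loewenheim-Skolem, if two sentences are distinguished by some
  structure (with universe in any type), they are distinguished by a countable one. The same holds
  with a universe embeddable into \<open>'a + nat\<close> for the sets \<open>T\<close> of \<open>closed_term_eqs\<close> below.\<close>

definition equiv_mod ::
  "('f, 'p) lang \<Rightarrow> 'a set \<Rightarrow> ('f, 'p, 'a) fm set \<Rightarrow> ('f, 'p, 'a) fm \<Rightarrow> ('f, 'p, 'a) fm \<Rightarrow> bool" where
  "equiv_mod L A T \<alpha> \<beta> \<longleftrightarrow>
     (\<forall>(N :: ('f, 'p, 'a + nat) model) h.
        is_structure L N \<and> h ` A \<subseteq> univ N \<and> (\<forall>\<tau> \<in> T. models N h \<tau>) \<longrightarrow>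
        (models N h \<alpha> \<longleftrightarrow> models N h \<beta>))"

abbreviation log_equiv ::
  "('f, 'p) lang \<Rightarrow> 'a set \<Rightarrow> ('f, 'p, 'a) fm \<Rightarrow> ('f, 'p, 'a) fm \<Rightarrow> bool" where
  "log_equiv L A \<equiv> equiv_mod L A {}"


section \<open>Choice functions and superposition semantics\<close>

type_synonym ('f, 'p, 'a) choice = "('f, 'p, 'a) fm uprod \<Rightarrow> ('f, 'p, 'a) fm"

text \<open>Values outside the sentences of \<open>L(M)\<close> are irrelevant. The condition
  \<open>f (Upair \<alpha> \<alpha>) = \<alpha>\<close> is the case \<open>\<alpha> = \<beta>\<close>.\<close>

definition choice_fun ::
  "('f, 'p) lang \<Rightarrow> ('f, 'p, 'a) model \<Rightarrow> ('f, 'p, 'a) choice \<Rightarrow> bool" where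
  "choice_fun L M f \<longleftrightarrow>
     (\<forall>\<alpha> \<in> Sen L (univ M). \<forall>\<beta> \<in> Sen L (univ M). f (Upair \<alpha> \<beta>) \<in> {\<alpha>, \<beta>})"

text \<open>The clauses for atomic formulas and for \<open>Forall\<close> say that a formula of \<open>L(M)\<close> is its own collapse
  (see \<open>collapse_Fml\<close>): in a basic formula, quantifiers occur only inside formulas of \<open>L(M)\<close>.\<close>

primrec collapse :: "('f, 'p, 'a) choice \<Rightarrow> ('f, 'p, 'a) fm \<Rightarrow> ('f, 'p, 'a) fm" where
  "collapse f (Eq s t) = Eq s t"
| "collapse f (Rel p ts) = Rel p ts"
| "collapse f (Neg \<phi>) = Neg (collapse f \<phi>)"
| "collapse f (And \<phi> \<psi>) = And (collapse f \<phi>) (collapse f \<psi>)"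
| "collapse f (Forall v \<phi>) = Forall v \<phi>"
| "collapse f (Super \<phi> \<psi>) = f (Upair (collapse f \<phi>) (collapse f \<psi>))"

lemma collapse_Fml: "\<alpha> \<in> Fml L A \<Longrightarrow> collapse f \<alpha> = \<alpha>"
  by (induction rule: Fml.induct) simp_all

primrec depth :: "('f, 'p, 'a) fm \<Rightarrow> nat" where
  "depth (Eq s t) = 0"
| "depth (Rel p ts) = 0"
| "depth (Neg \<phi>) = Suc (depth \<phi>)"
| "depth (And \<phi> \<psi>) = Suc (max (depth \<phi>) (depth \<psi>))"
| "depth (Forall v \<phi>) = Suc (depth \<phi>)"
| "depth (Super \<phi> \<psi>) = Suc (max (depth \<phi>) (depth \<psi>))"

lemma depth_subst [simp]: "depth (subst \<sigma> \<phi>) = depth \<phi>"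
  by (induction \<phi> arbitrary: \<sigma>) simp_all

text \<open>Truth of a restricted sentence of \<open>L\<^sub>s(M)\<close> in \<open>\<langle>M, f\<rangle>\<close>; on sentences of \<open>L(M)\<close> it is truth
  in \<open>M\<close> (see \<open>truth_Sen\<close>).\<close>

function truth :: "('f, 'p, 'a) model \<Rightarrow> ('f, 'p, 'a) choice \<Rightarrow> ('f, 'p, 'a) fm \<Rightarrow> bool" where
  "truth M f (Eq s t) \<longleftrightarrow> true_in M (Eq s t)"
| "truth M f (Rel p ts) \<longleftrightarrow> true_in M (Rel p ts)"
| "truth M f (Neg \<phi>) \<longleftrightarrow> \<not> truth M f \<phi>"
| "truth M f (And \<phi> \<psi>) \<longleftrightarrow> truth M f \<phi> \<and> truth M f \<psi>"
| "truth M f (Forall v \<phi>) \<longleftrightarrow> (\<forall>x \<in> univ M. truth M f (subst1 v (Name x) \<phi>))"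
| "truth M f (Super \<phi> \<psi>) \<longleftrightarrow> true_in M (f (Upair (collapse f \<phi>) (collapse f \<psi>)))"
  by pat_completeness auto
termination by (relation "measure (\<lambda>(M, f, \<phi>). depth \<phi>)") auto

lemma val_substt_names:
  assumes "\<forall>w. \<sigma> w = Var w \<or> (\<exists>x. \<sigma> w = Name x)"
  shows "val N h e (substt \<sigma> t) = val N h (\<lambda>w. val N h e (\<sigma> w)) t"
  by (induction t) (auto intro!: arg_cong2[where f = "fint N"] simp: comp_def)

lemma sat_subst_names:
  assumes "\<forall>w. \<sigma> w = Var w \<or> (\<exists>x. \<sigma> w = Name x)" and "\<alpha> \<in> Fml L A"
  shows "sat N h e (subst \<sigma> \<alpha>) = sat N h (\<lambda>w. val N h e (\<sigma> w)) \<alpha>"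
  using assms(2,1)
proof (induction arbitrary: \<sigma> e rule: Fml.induct)
  case (5 \<phi> v)
  have "(\<lambda>w. val N h (e(v := d)) ((\<sigma>(v := Var v)) w)) = (\<lambda>w. val N h e (\<sigma> w))(v := d)" for d
  proof
    fix w
    from 5(3) have "\<sigma> w = Var w \<or> (\<exists>x. \<sigma> w = Name x)" by blast
    then show "val N h (e(v := d)) ((\<sigma>(v := Var v)) w) = ((\<lambda>w. val N h e (\<sigma> w))(v := d)) w"
      by auto
  qed
  moreover have "\<forall>w. (\<sigma>(v := Var v)) w = Var w \<or> (\<exists>x. (\<sigma>(v := Var v)) w = Name x)"
    using 5(3) by auto
  ultimately show ?case
    using 5(2) by (simp del: fun_upd_apply)
qed (simp_all add: val_substt_names comp_def)

lemma subst_Fml: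
  assumes "\<alpha> \<in> Fml L A" and "\<forall>w. \<sigma> w \<in> Terms L A"
  shows "subst \<sigma> \<alpha> \<in> Fml L A"
proof -
  have t: "substt \<tau> t \<in> Terms L A" if "t \<in> Terms L A" "\<forall>w. \<tau> w \<in> Terms L A" for \<tau> t
    using that by (induction rule: Terms.induct) (auto intro!: Terms.intros)
  show ?thesis
    using assms
  proof (induction arbitrary: \<sigma> rule: Fml.induct)
    case (5 \<phi> v)
    then have "subst (\<sigma>(v := Var v)) \<phi> \<in> Fml L A" by (intro 5(2)) (simp add: Terms.intros)
    then show ?case by (simp add: Fml.intros)
  qed (auto intro!: Fml.intros t)
qed

lemma val_cong: "\<forall>v \<in> fvt t. e v = e' v \<Longrightarrow> val N h e t = val N h e' t"
  by (induction t) (auto intro!: arg_cong2[where f = "fint N"])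

lemma sat_cong:
  "\<alpha> \<in> Fml L A \<Longrightarrow> \<forall>v \<in> fv \<alpha>. e v = e' v \<Longrightarrow> sat N h e \<alpha> = sat N h e' \<alpha>"
proof (induction arbitrary: e e' rule: Fml.induct)
  case (1 s t)
  then show ?case using val_cong[of s e e' N h] val_cong[of t e e' N h] by simp
next
  case (2 p ts)
  have "map (val N h e) ts = map (val N h e') ts"
    using 2(3) by (auto intro!: val_cong)
  then show ?case by (simp del: map_eq_conv)
next
  case (5 \<phi> v)
  have "sat N h (e(v := d)) \<phi> = sat N h (e'(v := d)) \<phi>" for d
    using 5(3) by (intro 5(2)) auto
  then show ?case by simp
next
  case (4 \<phi> \<psi>)
  from 4(3)[of e e'] 4(4)[of e e'] 4(5) show ?case by simp
qed auto

lemma fv_subst_names: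
  fixes \<sigma> :: "nat \<Rightarrow> ('f, 'a) tm" and \<phi> :: "('f, 'p, 'a) fm"
  assumes "\<forall>w. \<sigma> w = Var w \<or> (\<exists>x. \<sigma> w = Name x)"
  shows "fv (subst \<sigma> \<phi>) \<subseteq> {w \<in> fv \<phi>. \<sigma> w = Var w}"
proof -
  have t: "fvt (substt \<tau> t) \<subseteq> {w \<in> fvt t. \<tau> w = Var w}"
    if "\<forall>w. \<tau> w = Var w \<or> (\<exists>x. \<tau> w = Name x)" for \<tau> :: "nat \<Rightarrow> ('f, 'a) tm" and t
  proof (induction t)
    case (Var w)
    then show ?case using that[rule_format, of w] by auto
  qed auto
  show ?thesis
    using assms
  proof (induction \<phi> arbitrary: \<sigma>)
    case (Eq r s)
    then show ?case using t[of \<sigma> r] t[of \<sigma> s] by auto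
  next
    case (Rel p ts)
    then show ?case using t[of \<sigma>] by fastforce
  next
    case (Forall w \<phi>)
    then have "fv (subst (\<sigma>(w := Var w)) \<phi>) \<subseteq> {u \<in> fv \<phi>. (\<sigma>(w := Var w)) u = Var u}"
      by (intro Forall.IH) simp
    then show ?case by (auto split: if_splits simp del: fun_upd_apply) (auto simp: subset_iff)
  next
    case (And \<phi> \<psi>)
    from And.IH[OF And.prems] show ?case by auto
  next
    case (Super \<phi> \<psi>)
    from Super.IH[OF Super.prems] show ?case by auto
  qed simp
qed

lemma truth_Sen:
  assumes "\<alpha> \<in> Sen L (univ M)" and "univ M \<noteq> {}"
  shows "truth M f \<alpha> \<longleftrightarrow> true_in M \<alpha>"
proof -
  from assms(2) obtain x0 where "x0 \<in> univ M" by auto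
  then obtain e where e: "\<forall>v :: nat. e v \<in> univ M" by (intro that[of "\<lambda>_. x0"]) simp
  have models_sat: "true_in M \<alpha> \<longleftrightarrow> sat M id e \<alpha>"
    if "\<alpha> \<in> Fml L (univ M)" "fv \<alpha> = {}" for \<alpha>
    using sat_cong[OF that(1)] that(2) e unfolding models_def by auto
  have "truth M f \<alpha> \<longleftrightarrow> sat M id e \<alpha>" if "\<alpha> \<in> Fml L (univ M)" "fv \<alpha> = {}" for \<alpha>
    using that
  proof (induction "depth \<alpha>" arbitrary: \<alpha> rule: less_induct)
    case less
    from less.prems(1) show ?case
    proof cases
      case (5 \<phi> v)
      have "truth M f (subst1 v (Name x) \<phi>) \<longleftrightarrow> sat M id (e(v := x)) \<phi>" if "x \<in> univ M" for x
      proof -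
        have "\<forall>w. (Var(v := Name x)) w = Var w \<or> (\<exists>y. (Var(v := Name x)) w = Name y)"
          by simp
        from fv_subst_names[OF this, of \<phi>] have "fv (subst1 v (Name x) \<phi>) = {}"
          using 5 less.prems(2) by (auto simp: fun_upd_def split: if_splits)
        moreover have "subst1 v (Name x) \<phi> \<in> Fml L (univ M)"
          using 5 that by (intro subst_Fml) (auto intro: Terms.intros)
        ultimately have "truth M f (subst1 v (Name x) \<phi>) \<longleftrightarrow> sat M id e (subst1 v (Name x) \<phi>)"
          using 5 by (intro less.hyps) auto
        also have "\<dots> \<longleftrightarrow> sat M id (\<lambda>w. val M id e ((Var(v := Name x)) w)) \<phi>"
          using 5 by (intro sat_subst_names) auto
        also have "(\<lambda>w. val M id e ((Var(v := Name x)) w)) = e(v := x)"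
          by auto
        finally show ?thesis .
      qed
      then show ?thesis using 5 by simp
    qed (use less models_sat[of \<alpha>] in auto)
  qed
  then show ?thesis
    using assms(1) models_sat by (auto simp: Sen_def)
qed

text \<open>A formula with free variables holds if all its closed instances by elements of \<open>M\<close> do;
  for sentences this is just \<open>truth\<close>.\<close>

definition holds :: "('f, 'p, 'a) model \<Rightarrow> ('f, 'p, 'a) choice \<Rightarrow> ('f, 'p, 'a) fm \<Rightarrow> bool" where
  "holds M f \<phi> \<longleftrightarrow>
     (\<forall>e. (\<forall>v. e v \<in> univ M) \<longrightarrow> truth M f (subst (\<lambda>v. Name (e v)) \<phi>))"

definition regular ::
  "('f, 'p) lang \<Rightarrow> ('f, 'p, 'a) model \<Rightarrow> ('f, 'p, 'a) choice \<Rightarrow> bool" where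
  "regular L M f \<longleftrightarrow>
     (\<forall>\<alpha> \<in> Sen L (univ M). \<forall>\<alpha>' \<in> Sen L (univ M). \<forall>\<beta> \<in> Sen L (univ M).
        log_equiv L (univ M) \<alpha> \<alpha>' \<longrightarrow>
        log_equiv L (univ M) (f (Upair \<alpha> \<beta>)) (f (Upair \<alpha>' \<beta>)))"

definition associative ::
  "('f, 'p) lang \<Rightarrow> ('f, 'p, 'a) model \<Rightarrow> ('f, 'p, 'a) choice \<Rightarrow> bool" where
  "associative L M f \<longleftrightarrow>
     (\<forall>\<alpha> \<in> Sen L (univ M). \<forall>\<beta> \<in> Sen L (univ M). \<forall>\<gamma> \<in> Sen L (univ M).
        f (Upair (f (Upair \<alpha> \<beta>)) \<gamma>) = f (Upair \<alpha> (f (Upair \<beta> \<gamma>))))"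

text \<open>Total orderings are given by their reflexive version \<open>r\<close>; \<open>below r\<close> is the strict one.\<close>

definition below :: "'b rel \<Rightarrow> 'b \<Rightarrow> 'b \<Rightarrow> bool" where
  "below r a b \<longleftrightarrow> (a, b) \<in> r \<and> a \<noteq> b"

definition regular_order ::
  "('f, 'p) lang \<Rightarrow> ('f, 'p, 'a) model \<Rightarrow> ('f, 'p, 'a) fm rel \<Rightarrow> bool" where
  "regular_order L M r \<longleftrightarrow>
     (\<forall>\<alpha> \<in> Sen L (univ M). \<forall>\<beta> \<in> Sen L (univ M).
        \<not> log_equiv L (univ M) \<alpha> \<beta> \<and> below r \<alpha> \<beta> \<longrightarrow>
        (\<forall>\<alpha>' \<in> Sen L (univ M). \<forall>\<beta>' \<in> Sen L (univ M).
           log_equiv L (univ M) \<alpha>' \<alpha> \<and> log_equiv L (univ M) \<beta>' \<beta> \<longrightarrow> below r \<alpha>' \<beta>'))"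

definition neg_decreasing ::
  "('f, 'p) lang \<Rightarrow> ('f, 'p, 'a) model \<Rightarrow> ('f, 'p, 'a) fm rel \<Rightarrow> bool" where
  "neg_decreasing L M r \<longleftrightarrow>
     (\<forall>\<alpha> \<in> Sen L (univ M). \<forall>\<beta> \<in> Sen L (univ M).
        \<not> log_equiv L (univ M) \<alpha> \<beta> \<longrightarrow> (below r \<alpha> \<beta> \<longleftrightarrow> below r (Neg \<beta>) (Neg \<alpha>)))"

text \<open>A class of choice functions is a set of pairs \<open>(M, f)\<close> with \<open>f\<close> a choice function for \<open>M\<close>. The
  universes of the structures are subsets of an arbitrary type \<open>'a\<close>.\<close>

type_synonym ('f, 'p, 'a) choice_class =
  "(('f, 'p, 'a) model \<times> ('f, 'p, 'a) choice) set"

definition Reg :: "('f, 'p) lang \<Rightarrow> ('f, 'p, 'a) choice_class" where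
  "Reg L = {(M, f). is_structure L M \<and> choice_fun L M f \<and> regular L M f}"

definition Reg_star :: "('f, 'p) lang \<Rightarrow> ('f, 'p, 'a) choice_class" where
  "Reg_star L = {(M, f) \<in> Reg L. associative L M f}"

definition Dec :: "('f, 'p) lang \<Rightarrow> ('f, 'p, 'a) choice_class" where
  "Dec L = {(M, f). is_structure L M \<and> choice_fun L M f \<and>
     (\<exists>r. linear_order_on (Sen L (univ M)) r \<and> regular_order L M r \<and> neg_decreasing L M r \<and>
        (\<forall>\<alpha> \<in> Sen L (univ M). \<forall>\<beta> \<in> Sen L (univ M).
           f (Upair \<alpha> \<beta>) = (if below r \<alpha> \<beta> then \<alpha> else \<beta>)))}"

text \<open>The equations \<open>t = x\<close> where \<open>t\<close> is a closed term of \<open>L\<close> with value \<open>x\<close> in \<open>M\<close>, and the choice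
  functions that do not separate a closed term from the name of its value, i.e. that are regular
  for equivalence modulo these equations as well. In logical equivalence, a closed term of \<open>L\<close>
  and the name of its value are unrelated, and then \<open>\<forall>v \<phi>(v) \<rightarrow> \<phi>(t)\<close> can fail: a regular \<open>f\<close> may
  treat the pair \<open>\<alpha>(t), \<beta>(t)\<close> differently from \<open>\<alpha>(x), \<beta>(x)\<close>. If \<open>L\<close> has no constants, there are
  no closed terms, and every \<open>(M, f) \<in> Reg L\<close> lies in \<open>Coh L\<close>.\<close>

definition closed_term_eqs ::
  "('f, 'p) lang \<Rightarrow> ('f, 'p, 'a) model \<Rightarrow> ('f, 'p, 'a) fm set" where
  "closed_term_eqs L M = {Eq t (Name x) | t x.
     t \<in> Terms L {} \<and> fvt t = {} \<and> x \<in> univ M \<and> true_in M (Eq t (Name x))}"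

definition Coh :: "('f, 'p) lang \<Rightarrow> ('f, 'p, 'a) choice_class" where
  "Coh L = {(M, f).
     \<forall>\<alpha> \<in> Sen L (univ M). \<forall>\<alpha>' \<in> Sen L (univ M). \<forall>\<beta> \<in> Sen L (univ M).
        equiv_mod L (univ M) (closed_term_eqs L M) \<alpha> \<alpha>' \<longrightarrow>
        equiv_mod L (univ M) (closed_term_eqs L M) (f (Upair \<alpha> \<beta>)) (f (Upair \<alpha>' \<beta>))}"

lemma no_closed_terms:
  assumes "\<forall>c. (c, 0) \<notin> funs L" and "t \<in> Terms L {}"
  shows "fvt t \<noteq> {}"
  using assms(2)
proof (induction rule: Terms.induct)
  case (3 g ts)
  with assms(1) have "ts \<noteq> []" by auto
  with 3 show ?case by (cases ts) auto
qed auto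

lemma Reg_subset_Coh:
  "\<forall>c. (c, 0) \<notin> funs L \<Longrightarrow> (Reg L :: ('f, 'p, 'a) choice_class) \<subseteq> Coh L"
proof -
  assume "\<forall>c. (c, 0) \<notin> funs L"
  then have "closed_term_eqs L M = {}" for M :: "('f, 'p, 'a) model"
    using no_closed_terms[of L] by (auto simp: closed_term_eqs_def)
  then show "(Reg L :: ('f, 'p, 'a) choice_class) \<subseteq> Coh L"
    by (auto simp: Reg_def Coh_def regular_def)
qed

definition entails ::
  "('f, 'p, 'a) choice_class \<Rightarrow> ('f, 'p, 'a) fm set \<Rightarrow> ('f, 'p, 'a) fm \<Rightarrow> bool" where
  "entails X \<Sigma> \<phi> \<longleftrightarrow> (\<forall>(M, f) \<in> X. (\<forall>\<sigma> \<in> \<Sigma>. holds M f \<sigma>) \<longrightarrow> holds M f \<phi>)"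

definition Taut ::
  "('f, 'p) lang \<Rightarrow> ('f, 'p, 'a) choice_class \<Rightarrow> ('f, 'p, 'a) fm set" where
  "Taut L X = {\<phi> \<in> Restricted L {}. entails X {} \<phi>}"


section \<open>Formal systems\<close>

text \<open>A rule is the set of its instances (premises, conclusion).\<close>

type_synonym ('f, 'p, 'a) rule = "(('f, 'p, 'a) fm list \<times> ('f, 'p, 'a) fm) set"

record ('f, 'p, 'a) formal_system =
  Ax :: "('f, 'p, 'a) fm set"
  Rules :: "('f, 'p, 'a) rule set"

inductive provable ::
  "('f, 'p) lang \<Rightarrow> ('f, 'p, 'a) formal_system \<Rightarrow> ('f, 'p, 'a) fm set \<Rightarrow> ('f, 'p, 'a) fm \<Rightarrow> bool"
  for L :: "('f, 'p) lang" and S :: "('f, 'p, 'a) formal_system" and \<Sigma> :: "('f, 'p, 'a) fm set"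
where
  Hyp: "\<phi> \<in> \<Sigma> \<Longrightarrow> \<phi> \<in> Restricted L {} \<Longrightarrow> provable L S \<Sigma> \<phi>"
| Axiom: "\<phi> \<in> Ax S \<Longrightarrow> \<phi> \<in> Restricted L {} \<Longrightarrow> provable L S \<Sigma> \<phi>"
| Rule: "R \<in> Rules S \<Longrightarrow> (\<psi>s, \<phi>) \<in> R \<Longrightarrow> \<forall>\<psi> \<in> set \<psi>s. provable L S \<Sigma> \<psi> \<Longrightarrow>
    \<phi> \<in> Restricted L {} \<Longrightarrow> provable L S \<Sigma> \<phi>"

definition MP :: "('f, 'p, 'a) rule" where
  "MP = {([\<phi>, Imp \<phi> \<psi>], \<psi>) | \<phi> \<psi>. True}"

definition GR :: "('f, 'p, 'a) rule" where
  "GR = {([\<phi>], Forall v \<phi>) | \<phi> v. True}"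

definition prop_axioms :: "('f, 'p) lang \<Rightarrow> ('f, 'p, 'a) fm set" where
  "prop_axioms L =
     {Imp \<phi> (Imp \<psi> \<phi>) | \<phi> \<psi>. \<phi> \<in> Restricted L {} \<and> \<psi> \<in> Restricted L {}} \<union>
     {Imp (Imp \<phi> (Imp \<psi> \<sigma>)) (Imp (Imp \<phi> \<psi>) (Imp \<phi> \<sigma>)) | \<phi> \<psi> \<sigma>.
        \<phi> \<in> Restricted L {} \<and> \<psi> \<in> Restricted L {} \<and> \<sigma> \<in> Restricted L {}} \<union>
     {Imp (Imp (Neg \<phi>) (Neg \<psi>)) (Imp (Imp (Neg \<phi>) \<psi>) \<phi>) | \<phi> \<psi>.
        \<phi> \<in> Restricted L {} \<and> \<psi> \<in> Restricted L {}}"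

definition quant_axioms :: "('f, 'p) lang \<Rightarrow> ('f, 'p, 'a) fm set" where
  "quant_axioms L =
     {Imp (Forall v \<phi>) (subst1 v t \<phi>) | v \<phi> t.
        \<phi> \<in> Restricted L {} \<and> t \<in> Terms L {} \<and> fvt t = {}} \<union>
     {Imp (Forall v (Imp \<phi> \<psi>)) (Imp \<phi> (Forall v \<psi>)) | v \<phi> \<psi>.
        \<phi> \<in> Restricted L {} \<and> \<psi> \<in> Restricted L {} \<and> v \<notin> fv \<phi>}"

text \<open>The equality axioms are those of first-order logic in \<open>L\<close>. Substitution of equals inside the
  scope of \<open>|\<close> is not included: with it, \<open>SV\<close> would not preserve truth for regular choice functions.
  (Let \<open>\<phi>\<close>, \<open>\<psi>\<close> be \<open>u = v \<and> (\<alpha>(u)|\<beta>(u))\<close> and \<open>u = v \<and> (\<alpha>(v)|\<beta>(v))\<close>. Their instances by distinct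
  elements need not have logically equivalent collapses.)\<close>

definition eq_axioms :: "('f, 'p) lang \<Rightarrow> ('f, 'p, 'a) fm set" where
  "eq_axioms L =
     {Eq t t | t. t \<in> Terms L {}} \<union>
     {Imp (Eq s t) (Imp (subst1 v s \<alpha>) (subst1 v t \<alpha>)) | s t v \<alpha>.
        s \<in> Terms L {} \<and> t \<in> Terms L {} \<and> \<alpha> \<in> Fml L {} \<and> free_for s v \<alpha> \<and> free_for t v \<alpha>}"

definition S1 :: "('f, 'p) lang \<Rightarrow> ('f, 'p, 'a) fm set" where
  "S1 L = {Imp (And \<phi> \<psi>) (Super \<phi> \<psi>) | \<phi> \<psi>. \<phi> \<in> Basic L {} \<and> \<psi> \<in> Basic L {}}"

definition S2 :: "('f, 'p) lang \<Rightarrow> ('f, 'p, 'a) fm set" where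
  "S2 L = {Imp (Super \<phi> \<psi>) (Or \<phi> \<psi>) | \<phi> \<psi>. \<phi> \<in> Basic L {} \<and> \<psi> \<in> Basic L {}}"

definition S3 :: "('f, 'p) lang \<Rightarrow> ('f, 'p, 'a) fm set" where
  "S3 L = {Imp (Super \<phi> \<psi>) (Super \<psi> \<phi>) | \<phi> \<psi>. \<phi> \<in> Basic L {} \<and> \<psi> \<in> Basic L {}}"

definition S4 :: "('f, 'p) lang \<Rightarrow> ('f, 'p, 'a) fm set" where
  "S4 L = {Imp (Super (Super \<phi> \<psi>) \<sigma>) (Super \<phi> (Super \<psi> \<sigma>)) | \<phi> \<psi> \<sigma>.
     \<phi> \<in> Basic L {} \<and> \<psi> \<in> Basic L {} \<and> \<sigma> \<in> Basic L {}}"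

definition S5 :: "('f, 'p) lang \<Rightarrow> ('f, 'p, 'a) fm set" where
  "S5 L = {Imp (And \<phi> (Neg \<psi>)) (Iff (Super \<phi> \<psi>) (Super (Neg \<phi>) (Neg \<psi>))) | \<phi> \<psi>.
     \<phi> \<in> Basic L {} \<and> \<psi> \<in> Basic L {}}"

definition Lambda0 :: "('f, 'p) lang \<Rightarrow> ('f, 'p, 'a) formal_system" where
  "Lambda0 L =
     \<lparr>Ax = prop_axioms L \<union> quant_axioms L \<union> eq_axioms L \<union> S1 L \<union> S2 L \<union> S3 L,
      Rules = {MP, GR}\<rparr>"

definition SV :: "('f, 'p) lang \<Rightarrow> ('f, 'p, 'a) rule" where
  "SV L = {([], Iff (Super \<phi> \<sigma>) (Super \<psi> \<sigma>)) | \<phi> \<psi> \<sigma>.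
     \<phi> \<in> Basic L {} \<and> \<psi> \<in> Basic L {} \<and> \<sigma> \<in> Basic L {} \<and>
     provable L (Lambda0 L) {} (Iff \<phi> \<psi>)}"

definition Lambda1 :: "('f, 'p) lang \<Rightarrow> ('f, 'p, 'a) formal_system" where
  "Lambda1 L = \<lparr>Ax = Ax (Lambda0 L), Rules = {MP, GR, SV L}\<rparr>"

definition Lambda2 :: "('f, 'p) lang \<Rightarrow> ('f, 'p, 'a) formal_system" where
  "Lambda2 L = \<lparr>Ax = Ax (Lambda1 L) \<union> S4 L, Rules = {MP, GR, SV L}\<rparr>"

definition Lambda3 :: "('f, 'p) lang \<Rightarrow> ('f, 'p, 'a) formal_system" where
  "Lambda3 L = \<lparr>Ax = Ax (Lambda2 L) \<union> S5 L, Rules = {MP, GR, SV L}\<rparr>"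

text \<open>Soundness of the logic \<open>RFOLS(X, S)\<close>.\<close>

definition RFOLS_sound ::
  "('f, 'p) lang \<Rightarrow> ('f, 'p, 'a) choice_class \<Rightarrow> ('f, 'p, 'a) formal_system \<Rightarrow> bool" where
  "RFOLS_sound L X S \<longleftrightarrow>
     (\<forall>\<Sigma> \<phi>. (\<forall>\<sigma> \<in> \<Sigma>. \<sigma> \<in> Restricted L {} \<and> fv \<sigma> = {}) \<and> \<phi> \<in> Restricted L {} \<and> fv \<phi> = {} \<longrightarrow>
        provable L S \<Sigma> \<phi> \<longrightarrow> entails X \<Sigma> \<phi>)"

end

theory Submission
  imports Defs
begin

text \<open>The only rule whose soundness is not immediate is \<open>SV\<close>: if \<open>\<Lambda>\<^sub>0\<close> proves \<open>\<phi> \<leftrightarrow> \<psi>\<close>, the collapses of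
  corresponding instances of \<open>\<phi>\<close> and \<open>\<psi>\<close> must be logically equivalent, so that regularity of \<open>f\<close>
  applies. Let \<open>N\<close> be any \<open>L(M)\<close>-structure. Evaluate restricted formulas in \<open>N\<close>, letting
  variables range over the closed terms of \<open>L(M)\<close>, kept as syntactic objects, and the elements of
  \<open>N\<close>; a basic formula all of whose variables denote closed terms is true iff \<open>N\<close> satisfies the
  collapse of the resulting sentence. In this semantics \<open>\<Lambda>\<^sub>0\<close> is sound for every choice function:
  instantiating a variable by a closed term is literally a case of the quantifier. Truth in
  \<open>\<langle>M, f\<rangle>\<close> is the case \<open>N = M\<close> with only the names of elements as values; there, instantiation
  needs coherence, which makes the collapses of \<open>\<phi>(t)\<close> and \<open>\<phi>(x)\<close> equivalent when \<open>x\<close> is the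
  value of \<open>t\<close>.\<close>

section \<open>Substitution and satisfaction\<close>

text \<open>Such substitutions cannot capture: an inserted term is closed, and any other variable
  stays fixed. This makes the non-renaming \<open>subst\<close> well behaved. Instantiation of one
  variable by a closed term and simultaneous instantiation by names are both of this form.\<close>

definition ground :: "(nat \<Rightarrow> ('f, 'a) tm) \<Rightarrow> bool" where
  "ground \<sigma> \<longleftrightarrow> (\<forall>w. \<sigma> w = Var w \<or> fvt (\<sigma> w) = {})"

lemma groundD: "ground \<sigma> \<Longrightarrow> \<sigma> w = Var w \<or> fvt (\<sigma> w) = {}"
  by (simp add: ground_def)

lemma ground_upd_Var [simp]: "ground \<sigma> \<Longrightarrow> ground (\<sigma>(v := Var v))"
  by (simp add: ground_def)

lemma ground_single [simp]: "fvt t = {} \<Longrightarrow> ground (Var(v := t))"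
  by (simp add: ground_def)

lemma substt_cong: "\<forall>w \<in> fvt t. \<sigma> w = \<tau> w \<Longrightarrow> substt \<sigma> t = substt \<tau> t"
  by (induction t) auto

lemma substt_Var [simp]: "substt Var t = t"
  by (induction t) (auto intro: map_idI)

lemma substt_closed [simp]: "fvt t = {} \<Longrightarrow> substt \<sigma> t = t"
  using substt_cong[of t \<sigma> Var] by simp

lemma subst_cong: "\<forall>w \<in> fv \<phi>. \<sigma> w = \<tau> w \<Longrightarrow> subst \<sigma> \<phi> = subst \<tau> \<phi>"
proof (induction \<phi> arbitrary: \<sigma> \<tau>)
  case (Forall v \<phi>)
  then have "subst (\<sigma>(v := Var v)) \<phi> = subst (\<tau>(v := Var v)) \<phi>"
    by (intro Forall.IH) auto
  then show ?case by simp
next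
  case (And \<phi> \<psi>)
  from And.IH[of \<sigma> \<tau>] And.prems show ?case by simp
next
  case (Super \<phi> \<psi>)
  from Super.IH[of \<sigma> \<tau>] Super.prems show ?case by simp
qed (auto intro!: substt_cong)

lemma subst_Var [simp]: "subst Var \<phi> = \<phi>"
proof (induction \<phi>)
  case (Forall v \<phi>)
  have "Var(v := Var v) = Var" by (rule fun_upd_triv)
  with Forall show ?case by (simp del: fun_upd_apply)
qed (auto intro: map_idI)

lemma substt_substt: "substt \<tau> (substt \<sigma> t) = substt (\<lambda>w. substt \<tau> (\<sigma> w)) t"
  by (induction t) auto

text \<open>Below a quantifier over \<open>v\<close>, the term \<open>\<sigma> w\<close> for
  \<open>w \<noteq> v\<close> is closed or is \<open>Var w\<close>. Resetting \<open>\<tau>\<close>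
  at \<open>v\<close> therefore does not affect it, and the two substitutions still compose.\<close>

lemma subst_subst:
  assumes "ground \<sigma>"
  shows "subst \<tau> (subst \<sigma> \<phi>) = subst (\<lambda>w. substt \<tau> (\<sigma> w)) \<phi>"
  using assms
proof (induction \<phi> arbitrary: \<sigma> \<tau>)
  case (Forall v \<phi>)
  have "(\<lambda>w. substt (\<tau>(v := Var v)) ((\<sigma>(v := Var v)) w)) = (\<lambda>w. substt \<tau> (\<sigma> w))(v := Var v)"
  proof
    fix w
    show "substt (\<tau>(v := Var v)) ((\<sigma>(v := Var v)) w) = ((\<lambda>w. substt \<tau> (\<sigma> w))(v := Var v)) w"
      using groundD[OF Forall.prems, of w] by auto
  qed
  with Forall show ?case by (simp del: fun_upd_apply)
qed (auto simp: substt_substt)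

lemma fvt_substt_ground:
  assumes "ground \<sigma>"
  shows "fvt (substt \<sigma> t) = {w \<in> fvt t. \<sigma> w = Var w}"
proof (induction t)
  case (Var v)
  then show ?case using groundD[OF assms, of v] by auto
qed auto

text \<open>The exact set is given, not just an upper bound: the superposition clause of
  \<open>forces\<close> branches on the free variables, and the branch must be the same before and
  after a substitution.\<close>

lemma fv_subst_ground:
  assumes "ground \<sigma>"
  shows "fv (subst \<sigma> \<phi>) = {w \<in> fv \<phi>. \<sigma> w = Var w}"
  using assms
proof (induction \<phi> arbitrary: \<sigma>)
  case (Forall v \<phi>)
  have "fv (subst (\<sigma>(v := Var v)) \<phi>) = {w \<in> fv \<phi>. (\<sigma>(v := Var v)) w = Var w}"
    using Forall.prems by (intro Forall.IH ground_upd_Var)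
  then show ?case by auto
next
  case (And \<phi> \<psi>)
  from And.IH[OF And.prems] show ?case by auto
next
  case (Super \<phi> \<psi>)
  from Super.IH[OF Super.prems] show ?case by auto
qed (auto simp: fvt_substt_ground)

lemma fv_subst_closed:
  assumes "\<forall>w. fvt (\<sigma> w) = {}"
  shows "fv (subst \<sigma> \<phi>) = {}"
proof -
  have "\<sigma> w \<noteq> Var w" for w using assms by (metis fvt.simps(1) insert_not_empty)
  moreover have "ground \<sigma>" using assms by (simp add: ground_def)
  ultimately show ?thesis by (simp add: fv_subst_ground)
qed

section \<open>Enlarging the set of names, and substitution in basic formulas\<close>

lemma Terms_mono: "t \<in> Terms L A \<Longrightarrow> A \<subseteq> B \<Longrightarrow> t \<in> Terms L B"
  by (induction rule: Terms.induct) (auto intro!: Terms.intros)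

lemma Fml_mono: "\<phi> \<in> Fml L A \<Longrightarrow> A \<subseteq> B \<Longrightarrow> \<phi> \<in> Fml L B"
  by (induction rule: Fml.induct) (auto intro!: Fml.intros intro: Terms_mono)

lemma Basic_mono: "\<phi> \<in> Basic L A \<Longrightarrow> A \<subseteq> B \<Longrightarrow> \<phi> \<in> Basic L B"
  by (induction rule: Basic.induct) (auto intro: Basic.intros Fml_mono)

lemma subst_Basic:
  "\<phi> \<in> Basic L A \<Longrightarrow> \<forall>w. \<sigma> w \<in> Terms L A \<Longrightarrow> subst \<sigma> \<phi> \<in> Basic L A"
  by (induction rule: Basic.induct) (auto intro: Basic.intros subst_Fml)

section \<open>First-order satisfaction under substitution\<close>

lemma val_substt: "val N h e (substt \<sigma> t) = val N h (\<lambda>w. val N h e (\<sigma> w)) t"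
  by (induction t) (auto intro!: arg_cong2[where f = "fint N"])

lemma val_closed: "fvt t = {} \<Longrightarrow> val N h e t = val N h e' t"
  by (intro val_cong) simp

lemma val_in_univ:
  assumes "is_structure L N" "h ` A \<subseteq> univ N" "\<forall>v. e v \<in> univ N" "t \<in> Terms L A"
  shows "val N h e t \<in> univ N"
  using assms(4)
proof (induction rule: Terms.induct)
  case (3 g ts)
  then have "(g, length (map (val N h e) ts)) \<in> funs L" "set (map (val N h e) ts) \<subseteq> univ N"
    by auto
  then show ?case using assms(1) unfolding is_structure_def val.simps by blast
qed (use assms in auto)

lemma sat_subst_ground:
  assumes "\<alpha> \<in> Fml L A" "ground \<sigma>"
  shows "sat N h e (subst \<sigma> \<alpha>) = sat N h (\<lambda>w. val N h e (\<sigma> w)) \<alpha>"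
  using assms
proof (induction arbitrary: \<sigma> e rule: Fml.induct)
  case (5 \<phi> v)
  have "(\<lambda>w. val N h (e(v := d)) ((\<sigma>(v := Var v)) w)) = (\<lambda>w. val N h e (\<sigma> w))(v := d)" for d
  proof
    fix w
    show "val N h (e(v := d)) ((\<sigma>(v := Var v)) w) = ((\<lambda>w. val N h e (\<sigma> w))(v := d)) w"
      using groundD[OF 5(3), of w] val_closed[of "\<sigma> w" N h "e(v := d)" e] by auto
  qed
  with 5 show ?case by (simp del: fun_upd_apply)
qed (simp_all add: val_substt comp_def)

text \<open>Needed for the equality axioms, whose terms may contain variables. At a quantifier over
  \<open>w\<close>, either \<open>v\<close> is not free and both sides ignore it, or
  \<open>w\<close> does not occur in \<open>t\<close>, so the value of \<open>t\<close> survives the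
  change at \<open>w\<close>.\<close>

lemma sat_subst1:
  assumes "\<alpha> \<in> Fml L A" "free_for t v \<alpha>"
  shows "sat N h e (subst1 v t \<alpha>) = sat N h (e(v := val N h e t)) \<alpha>"
  using assms
proof (induction arbitrary: e rule: Fml.induct)
  case (5 \<phi> w)
  consider "v \<notin> fv (Forall w \<phi>)" | "v \<noteq> w" "w \<notin> fvt t" "free_for t v \<phi>"
    using 5(3) by auto
  then show ?case
  proof cases
    case 1
    then have "subst1 v t (Forall w \<phi>) = Forall w \<phi>"
      by (subst subst_cong[of "Forall w \<phi>" "Var(v := t)" Var])
        (auto simp del: subst.simps fv.simps)
    moreover have "sat N h e (Forall w \<phi>) = sat N h (e(v := val N h e t)) (Forall w \<phi>)"
      by (rule sat_cong[OF Fml.intros(5)[OF 5(1)]]) (use 1 in auto)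
    ultimately show ?thesis by (simp only:)
  next
    case 2
    have "(Var(v := t))(w := Var w) = Var(v := t)" using 2 by auto
    moreover have "val N h (e(w := d)) t = val N h e t" for d
      by (rule val_cong) (use 2 in auto)
    ultimately show ?thesis
      using 5(2)[OF 2(3)] 2(1) by (simp add: fun_upd_twist del: fun_upd_apply)
  qed
next
  case (1 s r)
  have "(\<lambda>w. val N h e ((Var(v := t)) w)) = e(v := val N h e t)" by auto
  then show ?case by (simp add: val_substt del: fun_upd_apply)
next
  case (2 p ts)
  have "(\<lambda>w. val N h e ((Var(v := t)) w)) = e(v := val N h e t)" by auto
  then show ?case by (simp add: val_substt comp_def del: fun_upd_apply)
qed auto

lemma models_sat:
  assumes "\<alpha> \<in> Fml L A" "fv \<alpha> = {}" "\<forall>v. e v \<in> univ N"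
  shows "models N h \<alpha> \<longleftrightarrow> sat N h e \<alpha>"
  using sat_cong[OF assms(1)] assms(2,3) unfolding models_def by blast

lemma ex_env:
  assumes "is_structure L N"
  obtains e where "\<forall>v :: nat. e v \<in> univ N"
proof -
  from assms obtain d where "d \<in> univ N" by (auto simp: is_structure_def)
  then show thesis by (intro that[of "\<lambda>_. d"]) simp
qed

text \<open>Since \<open>models\<close> quantifies over environments, negation commutes with it only
  because the truth value of a sentence is the same in all of them and a nonempty universe provides
  at least one.\<close>

lemma models_Neg:
  assumes "is_structure L N" "\<alpha> \<in> Sen L A"
  shows "models N h (Neg \<alpha>) \<longleftrightarrow> \<not> models N h \<alpha>"
proof -
  obtain e where e: "\<forall>v :: nat. e v \<in> univ N" by (rule ex_env[OF assms(1)])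
  show ?thesis
    using models_sat[of \<alpha> L A e N h] models_sat[of "Neg \<alpha>" L A e N h] e assms(2)
    by (auto simp: Sen_def intro: Fml.intros)
qed

lemma models_And: "models N h (And \<alpha> \<beta>) \<longleftrightarrow> models N h \<alpha> \<and> models N h \<beta>"
  by (auto simp: models_def)

text \<open>Truth in \<open>M\<close> respects \<open>equiv_mod\<close>, although the latter only speaks about structures
  in \<open>'a + nat\<close>: one of them is a copy of \<open>M\<close>.\<close>

definition copy :: "('f, 'p, 'a) model \<Rightarrow> ('f, 'p, 'a + nat) model" where
  "copy M = \<lparr>univ = Inl ` univ M, fint = (\<lambda>g ds. Inl (fint M g (map projl ds))),
     rint = (\<lambda>p ds. rint M p (map projl ds))\<rparr>"

lemma copy_simps [simp]:
  "univ (copy M) = Inl ` univ M"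
  "fint (copy M) g ds = Inl (fint M g (map projl ds))"
  "rint (copy M) p ds = rint M p (map projl ds)"
  by (simp_all add: copy_def)

lemma is_structure_copy:
  fixes M :: "('f, 'p, 'a) model"
  assumes "is_structure L M"
  shows "is_structure L (copy M)"
proof -
  have "fint M g (map projl ds) \<in> univ M"
    if "(g, length ds) \<in> funs L" "set ds \<subseteq> Inl ` univ M" for g and ds :: "('a + nat) list"
  proof -
    from that(2) have "set (map projl ds) \<subseteq> univ M" by auto
    with that(1) assms show ?thesis unfolding is_structure_def by (metis length_map)
  qed
  then show ?thesis using assms by (auto simp: is_structure_def)
qed

lemma val_copy: "val (copy M) (Inl \<circ> h) (Inl \<circ> e) t = Inl (val M h e t)"
proof (induction t)
  case (Fn g ts)
  then have "map projl (map (val (copy M) (Inl \<circ> h) (Inl \<circ> e)) ts) = map (val M h e) ts"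
    unfolding map_map by (intro map_cong) (simp_all add: comp_def)
  then show ?case by (simp only: val.simps copy_simps)
qed auto

lemma sat_copy: "sat (copy M) (Inl \<circ> h) (Inl \<circ> e) \<alpha> = sat M h e \<alpha>"
proof (induction \<alpha> arbitrary: e)
  case (Rel p ts)
  have "map projl (map (val (copy M) (Inl \<circ> h) (Inl \<circ> e)) ts) = map (val M h e) ts"
    by (simp add: val_copy)
  then show ?case by (simp only: sat.simps copy_simps)
next
  case (Forall v \<alpha>)
  have "(Inl \<circ> e)(v := Inl x :: _ + nat) = Inl \<circ> e(v := x)" for x by auto
  with Forall show ?case by (simp del: fun_upd_apply comp_apply)
qed (simp_all add: val_copy)

lemma models_copy: "models (copy M) (Inl \<circ> h) \<alpha> \<longleftrightarrow> models M h \<alpha>"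
proof
  assume "models M h \<alpha>"
  show "models (copy M) (Inl \<circ> h) \<alpha>"
    unfolding models_def
  proof (intro allI impI)
    fix e :: "nat \<Rightarrow> _" assume e: "\<forall>v. e v \<in> univ (copy M)"
    then have "e v = Inl (projl (e v)) \<and> projl (e v) \<in> univ M" for v
      by (auto dest: spec[of _ v])
    \<comment> \<open>Every environment of the copy factors through \<open>Inl\<close>, so
      \<open>sat_copy\<close> applies to it.\<close>
    then have "e = Inl \<circ> (projl \<circ> e)" "\<forall>v. (projl \<circ> e) v \<in> univ M" by (auto simp: fun_eq_iff)
    with \<open>models M h \<alpha>\<close> show "sat (copy M) (Inl \<circ> h) e \<alpha>"
      using sat_copy[of M h "projl \<circ> e" \<alpha>] by (simp add: models_def)
  qed
next
  assume *: "models (copy M) (Inl \<circ> h) \<alpha>"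
  show "models M h \<alpha>"
    unfolding models_def
  proof (intro allI impI)
    fix e :: "nat \<Rightarrow> _" assume "\<forall>v. e v \<in> univ M"
    then have "\<forall>v. (Inl \<circ> e) v \<in> univ (copy M)" by simp
    with * show "sat M h e \<alpha>" using sat_copy[of M h e \<alpha>] by (metis models_def)
  qed
qed

lemma equiv_mod_true_in:
  assumes "equiv_mod L (univ M) T \<alpha> \<beta>" "is_structure L M" "\<forall>\<tau> \<in> T. true_in M \<tau>"
  shows "true_in M \<alpha> \<longleftrightarrow> true_in M \<beta>"
proof -
  have "(Inl \<circ> id) ` univ M \<subseteq> univ (copy M)" by auto
  moreover have "\<forall>\<tau> \<in> T. models (copy M) (Inl \<circ> id) \<tau>"
    using assms(3) by (simp only: models_copy)
  ultimately have "models (copy M) (Inl \<circ> id) \<alpha> \<longleftrightarrow> models (copy M) (Inl \<circ> id) \<beta>"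
    using is_structure_copy[OF assms(2)]
    by (intro assms(1)[unfolded equiv_mod_def, rule_format] conjI)
  then show ?thesis by (simp only: models_copy)
qed

section \<open>A semantics with closed terms as values of variables\<close>

text \<open>A variable takes as value a closed term of \<open>L(A)\<close> or an element of \<open>N\<close>. The choice function
  is only available for sentences of \<open>L(A)\<close>; in a superposition with a parameter from \<open>N\<close>, \<open>|\<close> is
  read as conjunction, which satisfies \<open>S\<^sub>1\<close>, \<open>S\<^sub>2\<close>, \<open>S\<^sub>3\<close> as well.\<close>

fun den :: "('f, 'p, 'd) model \<Rightarrow> ('a \<Rightarrow> 'd) \<Rightarrow> ('f, 'a) tm + 'd \<Rightarrow> 'd" where
  "den N h (Inl t) = val N h (\<lambda>_. undefined) t"
| "den N h (Inr d) = d"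

text \<open>The default \<open>Var v\<close> leaves a variable alone whose value is an element of
  \<open>N\<close>. The superposition clause of \<open>forces\<close> uses \<open>term_of\<close>
  only when no free variable has such a value.\<close>

definition term_of :: "(nat \<Rightarrow> ('f, 'a) tm + 'd) \<Rightarrow> nat \<Rightarrow> ('f, 'a) tm" where
  "term_of \<sigma> v = (case \<sigma> v of Inl t \<Rightarrow> t | Inr d \<Rightarrow> Var v)"

primrec forces :: "('f, 'p, 'd) model \<Rightarrow> ('a \<Rightarrow> 'd) \<Rightarrow> ('f, 'p, 'a) choice \<Rightarrow>
    (('f, 'a) tm + 'd) set \<Rightarrow> (nat \<Rightarrow> ('f, 'a) tm + 'd) \<Rightarrow> ('f, 'p, 'a) fm \<Rightarrow> bool" where
  "forces N h f D \<sigma> (Eq s t) \<longleftrightarrow>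
     val N h (\<lambda>v. den N h (\<sigma> v)) s = val N h (\<lambda>v. den N h (\<sigma> v)) t"
| "forces N h f D \<sigma> (Rel p ts) \<longleftrightarrow> rint N p (map (val N h (\<lambda>v. den N h (\<sigma> v))) ts)"
| "forces N h f D \<sigma> (Neg \<phi>) \<longleftrightarrow> \<not> forces N h f D \<sigma> \<phi>"
| "forces N h f D \<sigma> (And \<phi> \<psi>) \<longleftrightarrow> forces N h f D \<sigma> \<phi> \<and> forces N h f D \<sigma> \<psi>"
| "forces N h f D \<sigma> (Forall v \<phi>) \<longleftrightarrow> (\<forall>d \<in> D. forces N h f D (\<sigma>(v := d)) \<phi>)"
| "forces N h f D \<sigma> (Super \<phi> \<psi>) \<longleftrightarrow>
     (if \<forall>w \<in> fv \<phi> \<union> fv \<psi>. isl (\<sigma> w)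
      then models N h
        (f (Upair (collapse f (subst (term_of \<sigma>) \<phi>)) (collapse f (subst (term_of \<sigma>) \<psi>))))
      else forces N h f D \<sigma> \<phi> \<and> forces N h f D \<sigma> \<psi>)"

lemma term_of_cong: "\<sigma> v = \<tau> v \<Longrightarrow> term_of \<sigma> v = term_of \<tau> v"
  by (simp add: term_of_def)

lemma term_of_Inl [simp]: "term_of (\<lambda>v. Inl (\<rho> v)) = \<rho>"
  by (simp add: term_of_def fun_eq_iff)

lemma forces_cong: "\<forall>w \<in> fv \<phi>. \<sigma> w = \<tau> w \<Longrightarrow> forces N h f D \<sigma> \<phi> = forces N h f D \<tau> \<phi>"
proof (induction \<phi> arbitrary: \<sigma> \<tau>)
  case (Eq s t)
  then have "val N h (\<lambda>v. den N h (\<sigma> v)) r = val N h (\<lambda>v. den N h (\<tau> v)) r" if "r \<in> {s, t}" for r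
    using that by (intro val_cong) auto
  then show ?case by simp
next
  case (Rel p ts)
  then have "map (val N h (\<lambda>v. den N h (\<sigma> v))) ts = map (val N h (\<lambda>v. den N h (\<tau> v))) ts"
    by (intro map_cong val_cong) auto
  then show ?case by (simp only: forces.simps)
next
  case (And \<phi> \<psi>)
  from And.IH[of \<sigma> \<tau>] And.prems show ?case by simp
next
  case (Forall v \<phi>)
  then have "forces N h f D (\<sigma>(v := d)) \<phi> = forces N h f D (\<tau>(v := d)) \<phi>" for d
    by (intro Forall.IH) auto
  then show ?case by simp
next
  case (Super \<phi> \<psi>)
  have "subst (term_of \<sigma>) \<phi> = subst (term_of \<tau>) \<phi>" "subst (term_of \<sigma>) \<psi> = subst (term_of \<tau>) \<psi>"
    using Super.prems by (auto intro!: subst_cong term_of_cong)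
  moreover have "(\<forall>w \<in> fv \<phi> \<union> fv \<psi>. isl (\<sigma> w)) \<longleftrightarrow> (\<forall>w \<in> fv \<phi> \<union> fv \<psi>. isl (\<tau> w))"
    using Super.prems by auto
  ultimately show ?case using Super.IH[of \<sigma> \<tau>] Super.prems by simp
qed auto

text \<open>Values that are closed terms stay syntactic. Hence the choice function is applied to the
  same pair of sentences whether a term is written into the formula or assigned to the
  variable.\<close>

lemma forces_subst_ground:
  assumes "ground \<rho>"
  shows "forces N h f D \<sigma> (subst \<rho> \<phi>) =
    forces N h f D (\<lambda>w. if \<rho> w = Var w then \<sigma> w else Inl (\<rho> w)) \<phi>"
  using assms
proof (induction \<phi> arbitrary: \<rho> \<sigma>)
  case (Eq s t)
  have "(\<lambda>w. val N h (\<lambda>v. den N h (\<sigma> v)) (\<rho> w)) =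
      (\<lambda>w. den N h (if \<rho> w = Var w then \<sigma> w else Inl (\<rho> w)))"
    using Eq by (auto simp: fun_eq_iff dest: groundD intro: val_closed)
  then show ?case by (simp add: val_substt)
next
  case (Rel p ts)
  have "(\<lambda>w. val N h (\<lambda>v. den N h (\<sigma> v)) (\<rho> w)) =
      (\<lambda>w. den N h (if \<rho> w = Var w then \<sigma> w else Inl (\<rho> w)))"
    using Rel by (auto simp: fun_eq_iff dest: groundD intro: val_closed)
  then show ?case by (simp add: val_substt comp_def)
next
  case (Forall v \<phi>)
  have "(\<lambda>w. if (\<rho>(v := Var v)) w = Var w then (\<sigma>(v := d)) w else Inl ((\<rho>(v := Var v)) w)) =
      (\<lambda>w. if \<rho> w = Var w then \<sigma> w else Inl (\<rho> w))(v := d)" for d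
    by auto
  then show ?case using Forall.IH[OF ground_upd_Var[OF Forall.prems]]
    by (simp del: fun_upd_apply)
next
  case (Super \<phi> \<psi>)
  let ?\<sigma> = "\<lambda>w. if \<rho> w = Var w then \<sigma> w else Inl (\<rho> w)"
  have "(\<lambda>w. substt (term_of \<sigma>) (\<rho> w)) = term_of ?\<sigma>"
    using Super.prems by (auto simp: fun_eq_iff term_of_def dest: groundD)
  then have "subst (term_of \<sigma>) (subst \<rho> \<chi>) = subst (term_of ?\<sigma>) \<chi>" 
    if "\<chi> \<in> {\<phi>, \<psi>}" for \<chi>
    by (simp add: subst_subst[OF Super.prems])
  moreover have "(\<forall>w \<in> fv (subst \<rho> \<phi>) \<union> fv (subst \<rho> \<psi>). isl (\<sigma> w)) \<longleftrightarrow>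
      (\<forall>w \<in> fv \<phi> \<union> fv \<psi>. isl (?\<sigma> w))"
    by (auto simp: fv_subst_ground[OF Super.prems])
  ultimately show ?case
    using Super.IH[OF Super.prems]
    by (simp only: forces.simps subst.simps insert_iff simp_thms)
qed (simp_all only: forces.simps subst.simps)

lemma forces_subst1:
  assumes "fvt t = {}"
  shows "forces N h f D \<sigma> (subst1 v t \<phi>) = forces N h f D (\<sigma>(v := Inl t)) \<phi>"
proof -
  \<comment> \<open>A closed \<open>t\<close> differs from \<open>Var v\<close>, so the test picks
    out exactly \<open>v\<close>.\<close>
  have "(\<lambda>w. if (Var(v := t)) w = Var w then \<sigma> w else Inl ((Var(v := t)) w)) = \<sigma>(v := Inl t)"
    using assms by (auto simp: fun_eq_iff)
  then show ?thesis
    by (simp only: forces_subst_ground[OF ground_single[OF assms]])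
qed

section \<open>Frames, and soundness of \<open>Lambda0\<close> in them\<close>

definition vals :: "('f, 'p) lang \<Rightarrow> 'a set \<Rightarrow> ('f, 'p, 'd) model \<Rightarrow> (('f, 'a) tm + 'd) set" where
  "vals L A N = Inl ` {t \<in> Terms L A. fvt t = {}} \<union> Inr ` univ N"

lemma vals_Inl: "Inl t \<in> vals L A N \<longleftrightarrow> t \<in> Terms L A \<and> fvt t = {}"
  by (auto simp: vals_def)

lemma vals_Inr: "Inr d \<in> vals L A N \<longleftrightarrow> d \<in> univ N"
  by (auto simp: vals_def)

text \<open>The range \<open>D\<close> of the quantifiers is left open so that one development
  serves two cases: all of \<open>vals\<close>, used for \<open>SV\<close>, and only the names of
  elements, used for truth. \<open>D_onto\<close> ensures that either range reaches every element of
  \<open>N\<close>.\<close>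

locale frame =
  fixes L :: "('f, 'p) lang" and A :: "'a set" and N :: "('f, 'p, 'd) model" and h :: "'a \<Rightarrow> 'd"
    and f :: "('f, 'p, 'a) choice" and D :: "(('f, 'a) tm + 'd) set"
  assumes struct: "is_structure L N"
    and names: "h ` A \<subseteq> univ N"
    and choice: "\<And>\<alpha> \<beta>. \<alpha> \<in> Sen L A \<Longrightarrow> \<beta> \<in> Sen L A \<Longrightarrow> f (Upair \<alpha> \<beta>) \<in> {\<alpha>, \<beta>}"
    and D_vals: "D \<subseteq> vals L A N"
    and D_onto: "univ N \<subseteq> den N h ` D"
begin

lemma den_univ: "d \<in> vals L A N \<Longrightarrow> den N h d \<in> univ N"
proof (cases d)
  case (Inl t)
  assume "d \<in> vals L A N"
  with Inl have t: "t \<in> Terms L A" "fvt t = {}" by (auto simp: vals_Inl)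
  \<comment> \<open>\<open>den\<close> evaluates in an undefined environment, which may leave the
    universe; as \<open>t\<close> is closed, a proper environment gives the same value.\<close>
  obtain e where "\<forall>v :: nat. e v \<in> univ N" by (rule ex_env[OF struct])
  from val_in_univ[OF struct names this t(1)] val_closed[OF t(2)] show ?thesis
    by (metis Inl den.simps(1))
qed (auto simp: vals_Inr)

lemma den_D: "den N h ` D = univ N"
  using den_univ D_vals D_onto by auto

text \<open>Only denotations matter to a first-order formula, and \<open>den\<close> maps
  \<open>D\<close> onto the universe, so quantifying over \<open>D\<close> and over
  \<open>univ N\<close> amounts to the same.\<close>

lemma forces_Fml:
  "\<phi> \<in> Fml L B \<Longrightarrow> forces N h f D \<sigma> \<phi> \<longleftrightarrow> sat N h (\<lambda>v. den N h (\<sigma> v)) \<phi>"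
proof (induction arbitrary: \<sigma> rule: Fml.induct)
  case (5 \<phi> v)
  have "(\<lambda>w. den N h ((\<sigma>(v := d)) w)) = (\<lambda>w. den N h (\<sigma> w))(v := den N h d)" for d by auto
  with 5(2) have "forces N h f D \<sigma> (Forall v \<phi>) \<longleftrightarrow>
      (\<forall>x \<in> den N h ` D. sat N h ((\<lambda>w. den N h (\<sigma> w))(v := x)) \<phi>)"
    by (simp del: fun_upd_apply)
  then show ?case by (simp add: den_D)
qed auto

lemma term_of_Terms: "\<forall>v. \<sigma> v \<in> vals L A N \<Longrightarrow> term_of \<sigma> v \<in> Terms L A"
  by (auto simp: term_of_def split: sum.split intro: Terms.intros) (metis vals_Inl)

lemma ground_term_of: "\<forall>v. \<sigma> v \<in> vals L A N \<Longrightarrow> ground (term_of \<sigma>)"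
  by (auto simp: ground_def term_of_def split: sum.split) (metis vals_Inl empty_iff)

lemma fv_term_of:
  assumes "\<forall>v. \<sigma> v \<in> vals L A N" "\<forall>w \<in> fv \<phi>. isl (\<sigma> w)"
  shows "fv (subst (term_of \<sigma>) \<phi>) = {}"
proof -
  have "term_of \<sigma> w \<noteq> Var w" if "w \<in> fv \<phi>" for w
  proof -
    from that assms(2) obtain t where "\<sigma> w = Inl t" by (auto simp: isl_def)
    with assms(1) show ?thesis unfolding term_of_def
      by (metis fvt.simps(1) insert_not_empty sum.case(1) vals_Inl)
  qed
  then show ?thesis using fv_subst_ground[OF ground_term_of[OF assms(1)], of \<phi>] by auto
qed

lemma collapse_Sen:
  "\<phi> \<in> Basic L A \<Longrightarrow> fv \<phi> = {} \<Longrightarrow> collapse f \<phi> \<in> Sen L A"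
proof (induction rule: Basic.induct)
  case (4 \<phi> \<psi>)
  then have "collapse f \<phi> \<in> Sen L A" "collapse f \<psi> \<in> Sen L A" by auto
  with choice[OF this] show ?case by auto
qed (auto simp: Sen_def collapse_Fml intro: Fml.intros)

text \<open>The link between the semantics and the collapse. Superposition agrees by its clause,
  whose test succeeds here; a formula of \<open>L(A)\<close> agrees because an inserted closed term
  has the denotation of the variable; negation uses that the collapse is a sentence.\<close>

lemma forces_Basic:
  assumes "\<phi> \<in> Basic L A" "\<forall>v. \<sigma> v \<in> vals L A N" "\<forall>w \<in> fv \<phi>. isl (\<sigma> w)"
  shows "forces N h f D \<sigma> \<phi> \<longleftrightarrow> models N h (collapse f (subst (term_of \<sigma>) \<phi>))"
  using assms(1,3)
proof (induction rule: Basic.induct)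
  case (1 \<phi>)
  obtain e where e: "\<forall>v :: nat. e v \<in> univ N" by (rule ex_env[OF struct])
  have Fml: "subst (term_of \<sigma>) \<phi> \<in> Fml L A"
    using 1(1) term_of_Terms[OF assms(2)] by (simp add: subst_Fml)
  then have "models N h (collapse f (subst (term_of \<sigma>) \<phi>)) \<longleftrightarrow> sat N h e (subst (term_of \<sigma>) \<phi>)"
    using e fv_term_of[OF assms(2) 1(2)] by (simp add: collapse_Fml models_sat)
  also have "\<dots> \<longleftrightarrow> sat N h (\<lambda>w. val N h e (term_of \<sigma> w)) \<phi>"
    by (rule sat_subst_ground[OF 1(1) ground_term_of[OF assms(2)]])
  also have "\<dots> \<longleftrightarrow> sat N h (\<lambda>w. den N h (\<sigma> w)) \<phi>"
  proof (rule sat_cong[OF 1(1)], rule ballI)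
    fix w assume "w \<in> fv \<phi>"
    with 1(2) obtain t where t: "\<sigma> w = Inl t" by (auto simp: isl_def)
    with assms(2) have "fvt t = {}" by (metis vals_Inl)
    with t show "val N h e (term_of \<sigma> w) = den N h (\<sigma> w)"
      by (simp add: term_of_def val_closed[of t N h e])
  qed
  finally show ?case using forces_Fml[OF 1(1)] by simp
next
  case (2 \<phi>)
  then have "subst (term_of \<sigma>) \<phi> \<in> Basic L A" "fv (subst (term_of \<sigma>) \<phi>) = {}"
    using term_of_Terms[OF assms(2)] fv_term_of[OF assms(2)] by (auto intro: subst_Basic)
  with 2 show ?case using models_Neg[OF struct collapse_Sen] by simp
qed (auto simp: models_And)

lemma collapse_instance_Sen:
  assumes "\<phi> \<in> Basic L A" "\<forall>v. \<sigma> v \<in> vals L A N" "\<forall>w \<in> fv \<phi>. isl (\<sigma> w)"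
  shows "collapse f (subst (term_of \<sigma>) \<phi>) \<in> Sen L A"
  using assms term_of_Terms[OF assms(2)] fv_term_of[OF assms(2,3)]
  by (simp add: collapse_Sen subst_Basic)

text \<open>This is the content of \<open>S1\<close> and \<open>S2\<close>. If the choice function
  applies, it returns one of the two collapses; otherwise \<open>Super\<close> is read as a
  conjunction, for which both claims are immediate.\<close>

lemma forces_Super_between:
  assumes "\<phi> \<in> Basic L {}" "\<psi> \<in> Basic L {}" "\<forall>v. \<sigma> v \<in> vals L A N"
  shows "forces N h f D \<sigma> \<phi> \<Longrightarrow> forces N h f D \<sigma> \<psi> \<Longrightarrow> forces N h f D \<sigma> (Super \<phi> \<psi>)"
    and "forces N h f D \<sigma> (Super \<phi> \<psi>) \<Longrightarrow> forces N h f D \<sigma> \<phi> \<or> forces N h f D \<sigma> \<psi>"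
proof -
  have B: "\<phi> \<in> Basic L A" "\<psi> \<in> Basic L A" using assms(1,2) by (auto intro: Basic_mono)
  have "(forces N h f D \<sigma> \<phi> \<and> forces N h f D \<sigma> \<psi> \<longrightarrow> forces N h f D \<sigma> (Super \<phi> \<psi>)) \<and>
    (forces N h f D \<sigma> (Super \<phi> \<psi>) \<longrightarrow> forces N h f D \<sigma> \<phi> \<or> forces N h f D \<sigma> \<psi>)"
  proof (cases "\<forall>w \<in> fv \<phi> \<union> fv \<psi>. isl (\<sigma> w)")
    case True
    then have *: "\<forall>w \<in> fv \<phi>. isl (\<sigma> w)" "\<forall>w \<in> fv \<psi>. isl (\<sigma> w)" by auto
    have "f (Upair (collapse f (subst (term_of \<sigma>) \<phi>)) (collapse f (subst (term_of \<sigma>) \<psi>))) \<in>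
        {collapse f (subst (term_of \<sigma>) \<phi>), collapse f (subst (term_of \<sigma>) \<psi>)}"
      using B * assms(3) by (intro choice collapse_instance_Sen)
    then show ?thesis
      using True forces_Basic[OF B(1) assms(3) *(1)] forces_Basic[OF B(2) assms(3) *(2)] by auto
  qed auto
  then show "forces N h f D \<sigma> \<phi> \<Longrightarrow> forces N h f D \<sigma> \<psi> \<Longrightarrow> forces N h f D \<sigma> (Super \<phi> \<psi>)"
    and "forces N h f D \<sigma> (Super \<phi> \<psi>) \<Longrightarrow> forces N h f D \<sigma> \<phi> \<or> forces N h f D \<sigma> \<psi>" by blast+
qed

lemma forces_Super_commute: "forces N h f D \<sigma> (Super \<phi> \<psi>) = forces N h f D \<sigma> (Super \<psi> \<phi>)"
proof -
  have "Upair \<alpha> \<beta> = Upair \<beta> \<alpha>" for \<alpha> \<beta> :: "('f, 'p, 'a) fm" by simp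
  then have "models N h (f (Upair \<alpha> \<beta>)) \<longleftrightarrow> models N h (f (Upair \<beta> \<alpha>))" for \<alpha> \<beta>
    by metis
  from this[of "collapse f (subst (term_of \<sigma>) \<phi>)"] show ?thesis by (auto simp: Un_commute)
qed

text \<open>These axioms contain no superposition, so \<open>forces_Fml\<close> reduces them to
  ordinary satisfaction.\<close>

lemma forces_eq_axioms:
  assumes "\<phi> \<in> eq_axioms L"
  shows "forces N h f D \<sigma> \<phi>"
  using assms unfolding eq_axioms_def
proof (elim UnE CollectE exE conjE)
  fix s t v \<alpha>
  assume \<phi>: "\<phi> = Imp (Eq s t) (Imp (subst1 v s \<alpha>) (subst1 v t \<alpha>))"
    and st: "s \<in> Terms L {}" "t \<in> Terms L {}" and \<alpha>: "\<alpha> \<in> Fml L {}"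
    and free: "free_for s v \<alpha>" "free_for t v \<alpha>"
  have "\<forall>w. (Var(v := r)) w \<in> Terms L {}" if "r \<in> Terms L {}" for r :: "('f, 'a) tm"
    using that by (auto intro: Terms.intros)
  then have "subst1 v s \<alpha> \<in> Fml L {}" "subst1 v t \<alpha> \<in> Fml L {}"
    using st \<alpha> by (blast intro: subst_Fml)+
  then show ?thesis
    unfolding \<phi> Imp_def by (auto simp: forces_Fml sat_subst1[OF \<alpha>] free)
qed auto

text \<open>Instantiation by closed terms enters as the hypothesis \<open>inst\<close> because its
  justification depends on \<open>D\<close>: it is a case of the quantifier when \<open>D\<close>
  contains the closed terms, and it comes from coherence when \<open>D\<close> is
  \<open>elements M\<close>.\<close>

lemma forces_Lambda0_axioms:
  assumes "\<phi> \<in> Ax (Lambda0 L)" "\<forall>v. \<sigma> v \<in> D"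
    and inst: "\<And>v \<psi> t. \<psi> \<in> Restricted L {} \<Longrightarrow> t \<in> Terms L {} \<Longrightarrow> fvt t = {} \<Longrightarrow>
      forces N h f D \<sigma> (Forall v \<psi>) \<Longrightarrow> forces N h f D (\<sigma>(v := Inl t)) \<psi>"
  shows "forces N h f D \<sigma> \<phi>"
proof -
  have \<sigma>: "\<forall>v. \<sigma> v \<in> vals L A N" using assms(2) D_vals by auto
  from assms(1) consider "\<phi> \<in> prop_axioms L" | "\<phi> \<in> quant_axioms L" | "\<phi> \<in> eq_axioms L"
    | "\<phi> \<in> S1 L" | "\<phi> \<in> S2 L" | "\<phi> \<in> S3 L"
    by (auto simp: Lambda0_def)
  then show ?thesis
  proof cases
    case 1
    then show ?thesis by (auto simp: prop_axioms_def Imp_def)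
  next
    case 2
    then show ?thesis
      unfolding quant_axioms_def
    proof (elim UnE CollectE exE conjE)
      fix v \<psi> t
      assume "\<phi> = Imp (Forall v \<psi>) (subst1 v t \<psi>)"
        "\<psi> \<in> Restricted L {}" "t \<in> Terms L {}" "fvt t = {}"
      with inst[of \<psi> t v] show ?thesis
        by (auto simp: Imp_def forces_subst1 simp del: fun_upd_apply)
    next
      fix v \<psi> \<chi>
      assume \<phi>: "\<phi> = Imp (Forall v (Imp \<psi> \<chi>)) (Imp \<psi> (Forall v \<chi>))" and v: "v \<notin> fv \<psi>"
      have "forces N h f D (\<sigma>(v := d)) \<psi> = forces N h f D \<sigma> \<psi>" for d
        using v by (intro forces_cong) auto
      then show ?thesis unfolding \<phi> Imp_def by auto
    qed
  next
    case 3
    then show ?thesis by (rule forces_eq_axioms)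
  next
    case 4
    then obtain \<psi> \<chi> where \<phi>: "\<phi> = Imp (And \<psi> \<chi>) (Super \<psi> \<chi>)"
      and B: "\<psi> \<in> Basic L {}" "\<chi> \<in> Basic L {}" by (auto simp: S1_def)
    from forces_Super_between(1)[OF B \<sigma>] show ?thesis
      by (auto simp: \<phi> Imp_def simp del: forces.simps(6))
  next
    case 5
    then obtain \<psi> \<chi> where \<phi>: "\<phi> = Imp (Super \<psi> \<chi>) (Or \<psi> \<chi>)"
      and B: "\<psi> \<in> Basic L {}" "\<chi> \<in> Basic L {}" by (auto simp: S2_def)
    from forces_Super_between(2)[OF B \<sigma>] show ?thesis
      by (auto simp: \<phi> Imp_def Or_def simp del: forces.simps(6))
  next
    case 6
    then obtain \<psi> \<chi> where "\<phi> = Imp (Super \<psi> \<chi>) (Super \<chi> \<psi>)" by (auto simp: S3_def)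
    then show ?thesis using forces_Super_commute[of \<sigma> \<psi> \<chi>]
      by (simp add: Imp_def del: forces.simps(6))
  qed
qed

text \<open>The only rules are \<open>MP\<close> and \<open>GR\<close>, so no property of
  \<open>f\<close> beyond being a choice function enters. The assignment varies in the induction
  because \<open>GR\<close> changes the value of the generalized variable.\<close>

lemma Lambda0_sound:
  assumes "provable L (Lambda0 L) {} \<phi>"
    and closed_terms: "\<And>t. t \<in> Terms L {} \<Longrightarrow> fvt t = {} \<Longrightarrow> Inl t \<in> D"
  shows "\<forall>v. \<sigma> v \<in> D \<Longrightarrow> forces N h f D \<sigma> \<phi>"
  using assms(1)
proof (induction arbitrary: \<sigma> rule: provable.induct)
  case (Axiom \<phi>)
  from Axiom(1,3) show ?case
    by (rule forces_Lambda0_axioms) (simp add: closed_terms)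
next
  case (Rule R \<psi>s \<phi>)
  from Rule(1) have "R = MP \<or> R = GR" by (auto simp: Lambda0_def)
  then show ?case
  proof
    assume "R = MP"
    with Rule(2) obtain \<psi> where "\<psi>s = [\<psi>, Imp \<psi> \<phi>]" by (auto simp: MP_def)
    with Rule.IH Rule.prems have "forces N h f D \<sigma> \<psi>" "forces N h f D \<sigma> (Imp \<psi> \<phi>)" by auto
    then show ?thesis by (simp add: Imp_def)
  next
    assume "R = GR"
    with Rule(2) obtain \<psi> v where \<psi>: "\<psi>s = [\<psi>]" "\<phi> = Forall v \<psi>" by (auto simp: GR_def)
    have "forces N h f D (\<sigma>(v := d)) \<psi>" if "d \<in> D" for d
      using Rule.IH Rule.prems \<psi>(1) that by simp
    then show ?thesis by (simp add: \<psi>(2))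
  qed
qed simp

end

section \<open>Truth\<close>

text \<open>Elements enter as names, under \<open>Inl\<close>, so that every superposition is
  decided by the choice function, as in \<open>truth\<close>.\<close>

definition elements :: "('f, 'p, 'a) model \<Rightarrow> (('f, 'a) tm + 'a) set" where
  "elements M = (\<lambda>x. Inl (Name x)) ` univ M"

lemma choice_funD:
  "choice_fun L M f \<Longrightarrow> \<alpha> \<in> Sen L (univ M) \<Longrightarrow> \<beta> \<in> Sen L (univ M) \<Longrightarrow> f (Upair \<alpha> \<beta>) \<in> {\<alpha>, \<beta>}"
  by (simp add: choice_fun_def)

lemma frame_elements:
  assumes "is_structure L M" "choice_fun L M f"
  shows "frame L (univ M) M id f (elements M)"
proof
  show "f (Upair \<alpha> \<beta>) \<in> {\<alpha>, \<beta>}" if "\<alpha> \<in> Sen L (univ M)" "\<beta> \<in> Sen L (univ M)" for \<alpha> \<beta>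
    using assms(2) that by (rule choice_funD)
qed (use assms(1) in \<open>auto simp: elements_def vals_Inl image_image intro: Terms.intros\<close>)

text \<open>Both sides follow the same recursion. At a quantifier, putting \<open>Name x\<close> for
  \<open>v\<close> after the other names is the instance given by \<open>e(v := x)\<close>.\<close>

lemma truth_forces:
  fixes L :: "('f, 'p) lang" and M :: "('f, 'p, 'a) model"
  assumes "is_structure L M"
  shows "truth M f (subst (\<lambda>v. Name (e v)) \<phi>) \<longleftrightarrow>
    forces M id f (elements M) (\<lambda>v. Inl (Name (e v))) \<phi>"
proof (induction \<phi> arbitrary: e)
  case (Eq s t)
  \<comment> \<open>The universe is nonempty, so \<open>models\<close> does not hold vacuously for
    the closed instance.\<close>
  obtain u where "\<forall>v :: nat. u v \<in> univ M" by (rule ex_env[OF assms])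
  then show ?case by (auto simp: models_def val_substt id_def)
next
  case (Rel p ts)
  obtain u where "\<forall>v :: nat. u v \<in> univ M" by (rule ex_env[OF assms])
  then show ?case by (auto simp: models_def val_substt comp_def id_def)
next
  case (Forall v \<phi>)
  have "truth M f (subst1 v (Name x) (subst ((\<lambda>v. Name (e v))(v := Var v)) \<phi>)) \<longleftrightarrow>
      forces M id f (elements M) ((\<lambda>v. Inl (Name (e v)))(v := Inl (Name x))) \<phi>" for x
  proof -
    let ?s = "(\<lambda>v. Name (e v))(v := Var v) :: nat \<Rightarrow> ('f, 'a) tm"
    have "ground ?s" by (simp add: ground_def)
    moreover have "(\<lambda>w. substt (Var(v := Name x)) (?s w)) = (\<lambda>w. Name ((e(v := x)) w))"
      by auto
    moreover have "(\<lambda>w. Inl (Name ((e(v := x)) w))) =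
        ((\<lambda>v. Inl (Name (e v)))(v := Inl (Name x)) :: nat \<Rightarrow> ('f, 'a) tm + 'a)"
      by auto
    ultimately show ?thesis using Forall.IH[of "e(v := x)"] by (simp only: subst_subst)
  qed
  then show ?case by (simp add: elements_def del: fun_upd_apply id_apply)
next
  case (Super \<phi> \<psi>)
  show ?case by (simp del: id_apply)
qed (simp_all del: id_apply)

lemma holds_forces:
  assumes "is_structure L M"
  shows "holds M f \<phi> \<longleftrightarrow>
    (\<forall>e. (\<forall>v. e v \<in> univ M) \<longrightarrow> forces M id f (elements M) (\<lambda>v. Inl (Name (e v))) \<phi>)"
  by (simp add: holds_def truth_forces[OF assms])

lemma forces_elements_Basic:
  assumes "is_structure L M" "choice_fun L M f" "\<phi> \<in> Basic L {}" "\<forall>v. e v \<in> univ M"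
  shows "forces M id f (elements M) (\<lambda>v. Inl (Name (e v))) \<phi> \<longleftrightarrow>
      true_in M (collapse f (subst (\<lambda>v. Name (e v)) \<phi>))"
    and "collapse f (subst (\<lambda>v. Name (e v)) \<phi>) \<in> Sen L (univ M)"
proof -
  interpret frame L "univ M" M id f "elements M" using assms(1,2) by (rule frame_elements)
  have "\<phi> \<in> Basic L (univ M)" using assms(3) by (rule Basic_mono) simp
  moreover have "\<forall>v. Inl (Name (e v)) \<in> vals L (univ M) M"
    using assms(4) by (simp add: vals_Inl Terms.intros)
  ultimately show "forces M id f (elements M) (\<lambda>v. Inl (Name (e v))) \<phi> \<longleftrightarrow>
      true_in M (collapse f (subst (\<lambda>v. Name (e v)) \<phi>))"
    and "collapse f (subst (\<lambda>v. Name (e v)) \<phi>) \<in> Sen L (univ M)"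
    using forces_Basic[of \<phi> "\<lambda>v. Inl (Name (e v))"]
      collapse_instance_Sen[of \<phi> "\<lambda>v. Inl (Name (e v))"] by simp_all
qed

section \<open>The rule SV\<close>

lemma Lambda0_Iff_log_equiv:
  fixes L :: "('f, 'p) lang" and M :: "('f, 'p, 'a) model"
  assumes "is_structure L M" "choice_fun L M f"
    and \<phi>: "\<phi> \<in> Basic L {}" and \<psi>: "\<psi> \<in> Basic L {}"
    and prov: "provable L (Lambda0 L) {} (Iff \<phi> \<psi>)" and e: "\<forall>v. e v \<in> univ M"
  shows "log_equiv L (univ M)
    (collapse f (subst (\<lambda>v. Name (e v)) \<phi>)) (collapse f (subst (\<lambda>v. Name (e v)) \<psi>))"
  unfolding equiv_mod_def
proof (intro allI impI, elim conjE)
  fix N :: "('f, 'p, 'a + nat) model" and h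
  assume N: "is_structure L N" "h ` univ M \<subseteq> univ N"
  \<comment> \<open>With all of \<open>vals\<close>, the closed terms are values as
    \<open>Lambda0_sound\<close> requires, and the \<open>Inr\<close> part reaches all of
    \<open>N\<close>.\<close>
  define D where "D = vals L (univ M) N"
  interpret frame L "univ M" N h f D
  proof
    show "f (Upair \<alpha> \<beta>) \<in> {\<alpha>, \<beta>}" if "\<alpha> \<in> Sen L (univ M)" "\<beta> \<in> Sen L (univ M)" for \<alpha> \<beta>
      using assms(2) that by (rule choice_funD)
    show "univ N \<subseteq> den N h ` D" by (force simp: D_def vals_def image_iff)
  qed (use N in \<open>auto simp: D_def\<close>)
  \<comment> \<open>The names of elements of \<open>M\<close> are closed terms of
    \<open>L(M)\<close>. Under this assignment \<open>forces_Basic\<close> turns forcing of \<phi>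
    and \<psi> in \<open>N\<close> into truth of their collapses in \<open>N\<close>.\<close>
  let ?\<sigma> = "\<lambda>v. Inl (Name (e v)) :: _ + ('a + nat)"
  have \<sigma>: "\<forall>v. ?\<sigma> v \<in> D" using e by (auto simp: D_def vals_Inl intro: Terms.intros)
  have "forces N h f D ?\<sigma> (Iff \<phi> \<psi>)"
    by (rule Lambda0_sound[OF prov _ \<sigma>]) (auto simp: D_def vals_Inl intro: Terms_mono)
  then have "forces N h f D ?\<sigma> \<phi> \<longleftrightarrow> forces N h f D ?\<sigma> \<psi>"
    by (auto simp: Iff_def Imp_def)
  moreover have "\<phi> \<in> Basic L (univ M)" "\<psi> \<in> Basic L (univ M)"
    using \<phi> \<psi> by (auto intro: Basic_mono)
  ultimately show "models N h (collapse f (subst (\<lambda>v. Name (e v)) \<phi>)) \<longleftrightarrow>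
      models N h (collapse f (subst (\<lambda>v. Name (e v)) \<psi>))"
    using forces_Basic[OF _ \<sigma>[unfolded D_def]] by simp
qed

text \<open>Provable equivalence makes the collapses of \<phi> and \<psi> logically equivalent,
  regularity passes this on to the sentences chosen against the collapse of \<sigma>, and logically
  equivalent sentences agree in \<open>M\<close>.\<close>

lemma holds_SV:
  assumes "(M, f) \<in> Reg L" "(\<psi>s, \<chi>) \<in> SV L"
  shows "holds M f \<chi>"
proof -
  from assms(1) have M: "is_structure L M" "choice_fun L M f" and reg: "regular L M f"
    by (auto simp: Reg_def)
  from assms(2) obtain \<phi> \<sigma> \<psi> where \<chi>: "\<chi> = Iff (Super \<phi> \<sigma>) (Super \<psi> \<sigma>)"
    and B: "\<phi> \<in> Basic L {}" "\<psi> \<in> Basic L {}" "\<sigma> \<in> Basic L {}"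
    and prov: "provable L (Lambda0 L) {} (Iff \<phi> \<psi>)"
    by (auto simp: SV_def)
  have "forces M id f (elements M) (\<lambda>v. Inl (Name (e v))) \<chi>" if e: "\<forall>v. e v \<in> univ M" for e
  proof -
    let ?c = "\<lambda>\<phi>. collapse f (subst (\<lambda>v. Name (e v)) \<phi>)"
    have "log_equiv L (univ M) (?c \<phi>) (?c \<psi>)"
      using M B(1,2) prov e by (rule Lambda0_Iff_log_equiv)
    then have "log_equiv L (univ M) (f (Upair (?c \<phi>) (?c \<sigma>))) (f (Upair (?c \<psi>) (?c \<sigma>)))"
      using reg forces_elements_Basic(2)[OF M _ e] B by (auto simp: regular_def)
    then have "true_in M (?c (Super \<phi> \<sigma>)) \<longleftrightarrow> true_in M (?c (Super \<psi> \<sigma>))"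
      using equiv_mod_true_in[OF _ M(1)] by simp
    moreover have "Super \<phi> \<sigma> \<in> Basic L {}" "Super \<psi> \<sigma> \<in> Basic L {}"
      using B by (auto intro: Basic.intros)
    ultimately show ?thesis
      using forces_elements_Basic(1)[OF M _ e] by (simp add: \<chi> Iff_def Imp_def del: forces.simps(6))
  qed
  then show ?thesis by (simp add: holds_forces[OF M(1)])
qed

text \<open>Induction on the derivation for a fixed pair \<open>(M, f)\<close>. The invariant is
  \<open>holds\<close>, truth of all instances by elements, since derivations pass through open
  formulas. Derivations admit only restricted axioms; the intersection in the second assumption
  reflects this.\<close>

lemma sound_Reg:
  fixes L :: "('f, 'p) lang" and X :: "('f, 'p, 'a) choice_class"
  assumes "X \<subseteq> Reg L" "Ax S \<inter> Restricted L {} \<subseteq> Taut L X" "Rules S = {MP, GR, SV L}"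
    and prov: "provable L S \<Sigma> \<phi>"
  shows "entails X \<Sigma> \<phi>"
  unfolding entails_def
proof (clarify)
  fix M :: "('f, 'p, 'a) model" and f assume Mf: "(M, f) \<in> X" and \<Sigma>: "\<forall>\<sigma> \<in> \<Sigma>. holds M f \<sigma>"
  then have M: "is_structure L M" using assms(1) by (auto simp: Reg_def)
  from prov show "holds M f \<phi>"
  proof (induction rule: provable.induct)
    case (Axiom \<phi>)
    then have "entails X {} \<phi>" using assms(2) by (auto simp: Taut_def)
    with Mf show ?case by (auto simp: entails_def)
  next
    case (Rule R \<psi>s \<phi>)
    from Rule(1) assms(3) consider "R = MP" | "R = GR" | "R = SV L" by auto
    then show ?case
    proof cases
      case 1
      with Rule(2) obtain \<psi> where "\<psi>s = [\<psi>, Imp \<psi> \<phi>]" by (auto simp: MP_def)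
      with Rule.IH have "holds M f \<psi>" "holds M f (Imp \<psi> \<phi>)" by auto
      then show ?thesis by (simp add: holds_def Imp_def)
    next
      case 2
      with Rule(2) obtain \<psi> v where \<psi>: "\<psi>s = [\<psi>]" "\<phi> = Forall v \<psi>" by (auto simp: GR_def)
      with Rule.IH have *: "holds M f \<psi>" by simp
      \<comment> \<open>Generalization: the new value of \<open>v\<close> is absorbed into the
        environment as \<open>e(v := x)\<close>, which the premise covers.\<close>
      have "forces M id f (elements M) ((\<lambda>v. Inl (Name (e v)))(v := Inl (Name x))) \<psi>"
        if "\<forall>v. e v \<in> univ M" "x \<in> univ M" for e x
      proof -
        have "((\<lambda>v. Inl (Name (e v)))(v := Inl (Name x)) :: nat \<Rightarrow> ('f, 'a) tm + 'a) =
            (\<lambda>w. Inl (Name ((e(v := x)) w)))"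
          by auto
        moreover have "forces M id f (elements M) (\<lambda>w. Inl (Name ((e(v := x)) w))) \<psi>"
          using * that unfolding holds_forces[OF M] by (auto dest: spec[of _ "e(v := x)"])
        ultimately show ?thesis by (simp only:)
      qed
      then show ?thesis by (auto simp: holds_forces[OF M] \<psi>(2) elements_def simp del: fun_upd_apply id_apply)
    next
      case 3
      with Rule(2) Mf assms(1) show ?thesis by (auto intro: holds_SV)
    qed
  qed (use \<Sigma> in auto)
qed

section \<open>Tautologies of coherent choice functions\<close>

lemma closed_term_eqs_true: "\<tau> \<in> closed_term_eqs L M \<Longrightarrow> true_in M \<tau>"
  by (auto simp: closed_term_eqs_def)

lemma equiv_mod_sym: "equiv_mod L A T \<alpha> \<beta> \<Longrightarrow> equiv_mod L A T \<beta> \<alpha>"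
  unfolding equiv_mod_def by metis

lemma equiv_mod_trans:
  "equiv_mod L A T \<alpha> \<beta> \<Longrightarrow> equiv_mod L A T \<beta> \<gamma> \<Longrightarrow> equiv_mod L A T \<alpha> \<gamma>"
  unfolding equiv_mod_def by (metis (no_types, lifting))

text \<open>The counterpart of \<open>equiv_mod\<close> for closed terms. Modulo
  \<open>closed_term_eqs\<close>, it relates a closed term of \<open>L\<close> to the name of its
  value.\<close>

definition tm_equiv ::
  "('f, 'p) lang \<Rightarrow> 'a set \<Rightarrow> ('f, 'p, 'a) fm set \<Rightarrow> ('f, 'a) tm \<Rightarrow> ('f, 'a) tm \<Rightarrow> bool" where
  "tm_equiv L A T s t \<longleftrightarrow> s \<in> Terms L A \<and> t \<in> Terms L A \<and> fvt s = {} \<and> fvt t = {} \<and>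
     (\<forall>(N :: ('f, 'p, 'a + nat) model) h e.
        is_structure L N \<and> h ` A \<subseteq> univ N \<and> (\<forall>\<tau> \<in> T. models N h \<tau>) \<and> (\<forall>v. e v \<in> univ N) \<longrightarrow>
        val N h e s = val N h e t)"

lemma tm_equiv_refl: "t \<in> Terms L A \<Longrightarrow> fvt t = {} \<Longrightarrow> tm_equiv L A T t t"
  by (simp add: tm_equiv_def)

text \<open>First-order formulas see only the values of the inserted terms, and \<open>Neg\<close>
  and \<open>And\<close> respect equivalence. At a superposition, coherence says that
  \<open>f\<close> respects equivalence modulo the closed term equations.\<close>

lemma collapse_subst_equiv:
  fixes L :: "('f, 'p) lang" and M :: "('f, 'p, 'a) model"
  assumes M: "(M, f) \<in> Reg L \<inter> Coh L" and "\<phi> \<in> Basic L (univ M)"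
    and \<rho>: "\<forall>w. tm_equiv L (univ M) (closed_term_eqs L M) (\<rho> w) (\<rho>' w)"
  shows "equiv_mod L (univ M) (closed_term_eqs L M)
    (collapse f (subst \<rho> \<phi>)) (collapse f (subst \<rho>' \<phi>))"
proof -
  from M have "is_structure L M" "choice_fun L M f" by (auto simp: Reg_def)
  then interpret frame L "univ M" M id f "elements M" by (rule frame_elements)
  let ?E = "equiv_mod L (univ M) (closed_term_eqs L M)"
  have closed: "\<forall>w. fvt (\<rho> w) = {}" "\<forall>w. fvt (\<rho>' w) = {}"
    and Terms: "\<forall>w. \<rho> w \<in> Terms L (univ M)" "\<forall>w. \<rho>' w \<in> Terms L (univ M)"
    using \<rho> by (auto simp: tm_equiv_def)
  then have gr: "ground \<rho>" "ground \<rho>'" by (auto simp: ground_def)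
  have Sen: "collapse f (subst \<rho> \<psi>) \<in> Sen L (univ M)" "collapse f (subst \<rho>' \<psi>) \<in> Sen L (univ M)"
    if "\<psi> \<in> Basic L (univ M)" for \<psi>
    using that Terms closed by (auto intro!: collapse_Sen subst_Basic simp: fv_subst_closed)
  show ?thesis
    using assms(2)
  proof (induction rule: Basic.induct)
    case (1 \<alpha>)
    have F: "subst \<rho> \<alpha> \<in> Fml L (univ M)" "subst \<rho>' \<alpha> \<in> Fml L (univ M)"
      using 1 Terms by (auto intro: subst_Fml)
    have "?E (subst \<rho> \<alpha>) (subst \<rho>' \<alpha>)"
      unfolding equiv_mod_def
    proof (intro allI impI)
      fix N :: "('f, 'p, 'a + nat) model" and h
      assume N: "is_structure L N \<and> h ` univ M \<subseteq> univ N \<and> (\<forall>\<tau>\<in>closed_term_eqs L M. models N h \<tau>)"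
      then obtain e where e: "\<forall>v :: nat. e v \<in> univ N" using ex_env by metis
      have "(\<lambda>w. val N h e (\<rho> w)) = (\<lambda>w. val N h e (\<rho>' w))"
        using \<rho> N e by (auto simp: tm_equiv_def)
      then have "sat N h e (subst \<rho> \<alpha>) \<longleftrightarrow> sat N h e (subst \<rho>' \<alpha>)"
        by (simp add: sat_subst_ground[OF 1] gr)
      then show "models N h (subst \<rho> \<alpha>) \<longleftrightarrow> models N h (subst \<rho>' \<alpha>)"
        using F e closed by (simp add: models_sat fv_subst_closed)
    qed
    then show ?case by (simp add: collapse_Fml[OF F(1)] collapse_Fml[OF F(2)])
  next
    case (2 \<psi>)
    then show ?case using Sen[OF 2(1)] by (auto simp: equiv_mod_def models_Neg)
  next
    case (3 \<psi> \<chi>)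
    then show ?case by (simp add: equiv_mod_def models_And)
  next
    case (4 \<psi> \<chi>)
    let ?a = "collapse f (subst \<rho> \<psi>)" and ?a' = "collapse f (subst \<rho>' \<psi>)"
    let ?b = "collapse f (subst \<rho> \<chi>)" and ?b' = "collapse f (subst \<rho>' \<chi>)"
    have coh: "?E (f (Upair \<alpha> \<beta>)) (f (Upair \<alpha>' \<beta>))"
      if "\<alpha> \<in> Sen L (univ M)" "\<alpha>' \<in> Sen L (univ M)" "\<beta> \<in> Sen L (univ M)" "?E \<alpha> \<alpha>'" for \<alpha> \<alpha>' \<beta>
      using that M by (auto simp: Coh_def)
    have "?E (f (Upair ?a ?b)) (f (Upair ?a' ?b))"
      using 4 Sen by (intro coh)
    \<comment> \<open>Coherence varies only the first component, so the second is replaced with the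
      unordered pair written the other way round.\<close>
    moreover have "?E (f (Upair ?b ?a')) (f (Upair ?b' ?a'))"
      using 4 Sen by (intro coh)
    moreover have "Upair ?b ?a' = Upair ?a' ?b" "Upair ?b' ?a' = Upair ?a' ?b'" by simp_all
    ultimately show ?case by (simp only: collapse.simps subst.simps) (rule equiv_mod_trans)
  qed
qed

text \<open>For basic formulas the two collapses are equivalent modulo equations true in
  \<open>M\<close>, hence agree there. Quantifiers add only names, which are related to
  themselves.\<close>

lemma forces_elements_tm_equiv:
  fixes L :: "('f, 'p) lang" and M :: "('f, 'p, 'a) model"
  assumes M: "(M, f) \<in> Reg L \<inter> Coh L" and "\<phi> \<in> Restricted L {}"
    and "\<forall>w. tm_equiv L (univ M) (closed_term_eqs L M) (\<rho> w) (\<rho>' w)"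
  shows "forces M id f (elements M) (\<lambda>w. Inl (\<rho> w)) \<phi> \<longleftrightarrow>
    forces M id f (elements M) (\<lambda>w. Inl (\<rho>' w)) \<phi>"
proof -
  from M have S: "is_structure L M" "choice_fun L M f" by (auto simp: Reg_def)
  then interpret frame L "univ M" M id f "elements M" by (rule frame_elements)
  show ?thesis
    using assms(2,3)
  proof (induction arbitrary: \<rho> \<rho>' rule: Restricted.induct)
    case (1 \<phi>)
    have B: "\<phi> \<in> Basic L (univ M)" using 1(1) by (rule Basic_mono) simp
    have v: "\<forall>w. Inl (\<rho> w) \<in> vals L (univ M) M" "\<forall>w. Inl (\<rho>' w) \<in> vals L (univ M) M"
      using 1(2) by (auto simp: tm_equiv_def vals_Inl)
    have "true_in M (collapse f (subst \<rho> \<phi>)) \<longleftrightarrow> true_in M (collapse f (subst \<rho>' \<phi>))"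
      using collapse_subst_equiv[OF M B 1(2)] S(1)
      by (rule equiv_mod_true_in) (simp add: closed_term_eqs_true)
    moreover have "forces M id f (elements M) (\<lambda>w. Inl (\<rho> w)) \<phi> \<longleftrightarrow>
        true_in M (collapse f (subst \<rho> \<phi>))"
      by (subst forces_Basic[OF B v(1)]) simp_all
    moreover have "forces M id f (elements M) (\<lambda>w. Inl (\<rho>' w)) \<phi> \<longleftrightarrow>
        true_in M (collapse f (subst \<rho>' \<phi>))"
      by (subst forces_Basic[OF B v(2)]) simp_all
    ultimately show ?case by (simp only:)
  next
    case (4 \<phi> v)
    have "forces M id f (elements M) ((\<lambda>w. Inl (\<rho> w))(v := Inl (Name x))) \<phi> \<longleftrightarrow>
        forces M id f (elements M) ((\<lambda>w. Inl (\<rho>' w))(v := Inl (Name x))) \<phi>" if "x \<in> univ M" for x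
    proof -
      have "(\<lambda>w. Inl (\<tau> w) :: ('f, 'a) tm + 'a)(v := Inl (Name x)) = (\<lambda>w. Inl ((\<tau>(v := Name x)) w))" for \<tau>
        by auto
      moreover have "\<forall>w. tm_equiv L (univ M) (closed_term_eqs L M)
          ((\<rho>(v := Name x)) w) ((\<rho>'(v := Name x)) w)"
        using 4(3) that by (auto intro: tm_equiv_refl Terms.intros)
      ultimately show ?thesis using 4(2) by (simp only:)
    qed
    then show ?case by (auto simp: elements_def simp del: fun_upd_apply id_apply)
  qed auto
qed

lemma holds_Lambda0_axioms:
  fixes L :: "('f, 'p) lang" and M :: "('f, 'p, 'a) model"
  assumes M: "(M, f) \<in> Reg L \<inter> Coh L" and \<phi>: "\<phi> \<in> Ax (Lambda0 L)"
  shows "holds M f \<phi>"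
proof -
  from M have S: "is_structure L M" "choice_fun L M f" by (auto simp: Reg_def)
  then interpret frame L "univ M" M id f "elements M" by (rule frame_elements)
  have "forces M id f (elements M) (\<lambda>v. Inl (Name (e v))) \<phi>" if e: "\<forall>v. e v \<in> univ M" for e
    using \<phi>
  proof (rule forces_Lambda0_axioms)
    show "\<forall>v. Inl (Name (e v)) \<in> elements M" using e by (simp add: elements_def)
  next
    fix v and \<psi> :: "('f, 'p, 'a) fm" and t :: "('f, 'a) tm"
    assume \<psi>: "\<psi> \<in> Restricted L {}" and t: "t \<in> Terms L {}" "fvt t = {}"
      and all: "forces M id f (elements M) (\<lambda>v. Inl (Name (e v))) (Forall v \<psi>)"
    \<comment> \<open>The quantifier yields the instance by \<open>Name x\<close> for the value
      \<open>x\<close> of \<open>t\<close>; since \<open>Eq t (Name x)\<close> is among the closed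
      term equations, coherence carries it over to \<open>t\<close>.\<close>
    define x where "x = val M id e t"
    have t': "t \<in> Terms L (univ M)" using t(1) by (rule Terms_mono) simp
    then have x: "x \<in> univ M" unfolding x_def using e by (intro val_in_univ[OF S(1) names])
    have "true_in M (Eq t (Name x))"
      using val_closed[OF t(2), of M id] by (auto simp: models_def x_def)
    then have "Eq t (Name x) \<in> closed_term_eqs L M"
      using t x by (auto simp: closed_term_eqs_def)
    then have "val N h e (Name x) = val N h e t"
      if "\<forall>\<tau> \<in> closed_term_eqs L M. models N h \<tau>" "\<forall>v. e v \<in> univ N"
      for N :: "('f, 'p, 'a + nat) model" and h e
      using that by (force simp: models_def)
    then have "tm_equiv L (univ M) (closed_term_eqs L M) (Name x) t"
      using t' t(2) x by (auto simp: tm_equiv_def intro: Terms.intros)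
    moreover have "tm_equiv L (univ M) (closed_term_eqs L M) (Name (e w)) (Name (e w))" for w
      using e by (simp add: tm_equiv_refl Terms.intros)
    ultimately have "forces M id f (elements M) (\<lambda>w. Inl (((\<lambda>v. Name (e v))(v := Name x)) w)) \<psi> \<longleftrightarrow>
        forces M id f (elements M) (\<lambda>w. Inl (((\<lambda>v. Name (e v))(v := t)) w)) \<psi>"
      by (intro forces_elements_tm_equiv[OF M \<psi>]) simp
    moreover have "(\<lambda>w. Inl (((\<lambda>v. Name (e v))(v := r)) w)) =
        ((\<lambda>v. Inl (Name (e v)))(v := Inl r) :: nat \<Rightarrow> ('f, 'a) tm + 'a)" for r
      by auto
    ultimately show "forces M id f (elements M) ((\<lambda>v. Inl (Name (e v)))(v := Inl t)) \<psi>"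
      using all x by (simp add: elements_def del: fun_upd_apply id_apply)
  qed
  then show ?thesis by (simp add: holds_forces[OF S(1)])
qed

section \<open>The axioms \<open>S4\<close> and \<open>S5\<close>\<close>

lemma holds_S4:
  assumes M: "(M, f) \<in> Reg_star L" and \<chi>: "\<chi> \<in> S4 L"
  shows "holds M f \<chi>"
proof -
  from M have S: "is_structure L M" "choice_fun L M f" and assoc: "associative L M f"
    by (auto simp: Reg_star_def Reg_def)
  from \<chi> obtain \<phi> \<psi> \<sigma> where
    \<chi>: "\<chi> = Imp (Super (Super \<phi> \<psi>) \<sigma>) (Super \<phi> (Super \<psi> \<sigma>))"
    and B: "\<phi> \<in> Basic L {}" "\<psi> \<in> Basic L {}" "\<sigma> \<in> Basic L {}"
    by (auto simp: S4_def)
  have "forces M id f (elements M) (\<lambda>v. Inl (Name (e v))) \<chi>" if e: "\<forall>v. e v \<in> univ M" for e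
  proof -
    let ?c = "\<lambda>\<phi>. collapse f (subst (\<lambda>v. Name (e v)) \<phi>)"
    \<comment> \<open>Associativity makes the two collapses the same sentence, not merely equivalent
      ones.\<close>
    have "?c (Super (Super \<phi> \<psi>) \<sigma>) = ?c (Super \<phi> (Super \<psi> \<sigma>))"
      using assoc forces_elements_Basic(2)[OF S _ e] B by (simp add: associative_def)
    moreover have "Super (Super \<phi> \<psi>) \<sigma> \<in> Basic L {}" "Super \<phi> (Super \<psi> \<sigma>) \<in> Basic L {}"
      using B by (auto intro!: Basic.intros(4))
    ultimately show ?thesis
      using forces_elements_Basic(1)[OF S _ e] by (simp add: \<chi> Imp_def del: forces.simps(6))
  qed
  then show ?thesis by (simp add: holds_forces[OF S(1)])
qed

text \<open>If the first collapse is true and the second false, \<open>M\<close> itself shows them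
  inequivalent, so negation reverses their order. Then either the first collapse and the negation of
  the second are chosen, both true, or the second and the negation of the first, both false.\<close>

lemma holds_S5:
  assumes M: "(M, f) \<in> Dec L" and \<chi>: "\<chi> \<in> S5 L"
  shows "holds M f \<chi>"
proof -
  from M obtain r where S: "is_structure L M" "choice_fun L M f"
    and dec: "neg_decreasing L M r"
    and f: "\<And>\<alpha> \<beta>. \<alpha> \<in> Sen L (univ M) \<Longrightarrow> \<beta> \<in> Sen L (univ M) \<Longrightarrow>
      f (Upair \<alpha> \<beta>) = (if below r \<alpha> \<beta> then \<alpha> else \<beta>)"
    by (auto simp: Dec_def)
  from \<chi> obtain \<phi> \<psi> where
    \<chi>: "\<chi> = Imp (And \<phi> (Neg \<psi>)) (Iff (Super \<phi> \<psi>) (Super (Neg \<phi>) (Neg \<psi>)))"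
    and B: "\<phi> \<in> Basic L {}" "\<psi> \<in> Basic L {}"
    by (auto simp: S5_def)
  have "forces M id f (elements M) (\<lambda>v. Inl (Name (e v))) \<chi>" if e: "\<forall>v. e v \<in> univ M" for e
  proof -
    let ?c = "\<lambda>\<phi>. collapse f (subst (\<lambda>v. Name (e v)) \<phi>)"
    have "true_in M (?c (Super \<phi> \<psi>)) \<longleftrightarrow> true_in M (?c (Super (Neg \<phi>) (Neg \<psi>)))"
      if tf: "true_in M (?c \<phi>)" "\<not> true_in M (?c \<psi>)"
    proof -
      have Sen: "?c \<phi> \<in> Sen L (univ M)" "?c \<psi> \<in> Sen L (univ M)"
        using forces_elements_Basic(2)[OF S _ e] B by auto
      then have Sen': "Neg (?c \<phi>) \<in> Sen L (univ M)" "Neg (?c \<psi>) \<in> Sen L (univ M)"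
        by (auto simp: Sen_def intro: Fml.intros)
      have "\<not> log_equiv L (univ M) (?c \<phi>) (?c \<psi>)"
        using equiv_mod_true_in[OF _ S(1)] tf by blast
      then have "below r (?c \<phi>) (?c \<psi>) \<longleftrightarrow> below r (Neg (?c \<psi>)) (Neg (?c \<phi>))"
        using dec Sen by (auto simp: neg_decreasing_def)
      \<comment> \<open>Swapping the pair makes \<open>f\<close> test the very comparison that
        \<open>neg_decreasing\<close> provides.\<close>
      moreover have "Upair (Neg (?c \<phi>)) (Neg (?c \<psi>)) = Upair (Neg (?c \<psi>)) (Neg (?c \<phi>))"
        by simp
      then have "f (Upair (Neg (?c \<phi>)) (Neg (?c \<psi>))) =
          (if below r (Neg (?c \<psi>)) (Neg (?c \<phi>)) then Neg (?c \<psi>) else Neg (?c \<phi>))"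
        using f[OF Sen'(2,1)] by (simp only:)
      ultimately show ?thesis
        using tf f[OF Sen] models_Neg[OF S(1) Sen(1)] models_Neg[OF S(1) Sen(2)] by simp
    qed
    moreover have "Super \<phi> \<psi> \<in> Basic L {}" "Super (Neg \<phi>) (Neg \<psi>) \<in> Basic L {}"
      using B by (auto intro!: Basic.intros(2,4))
    ultimately show ?thesis
      using forces_elements_Basic(1)[OF S _ e] B
      by (auto simp: \<chi> Imp_def Iff_def simp del: forces.simps(6))
  qed
  then show ?thesis by (simp add: holds_forces[OF S(1)])
qed

text \<open>Regularity: either all sentences involved lie in one class, or a regular order compares
  equivalent sentences with \<beta> in the same way. Associativity: both bracketings give the least
  of the three sentences.\<close>

lemma Dec_subset_Reg_star: "(Dec L :: ('f, 'p, 'a) choice_class) \<subseteq> Reg_star L"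
proof (clarify)
  fix M :: "('f, 'p, 'a) model" and f
  assume "(M, f) \<in> Dec L"
  then obtain r where S: "is_structure L M" "choice_fun L M f"
    and lin: "linear_order_on (Sen L (univ M)) r" and reg: "regular_order L M r"
    and f: "\<And>\<alpha> \<beta>. \<alpha> \<in> Sen L (univ M) \<Longrightarrow> \<beta> \<in> Sen L (univ M) \<Longrightarrow>
      f (Upair \<alpha> \<beta>) = (if below r \<alpha> \<beta> then \<alpha> else \<beta>)"
    by (auto simp: Dec_def)
  let ?E = "log_equiv L (univ M)"
  have refl: "?E \<alpha> \<alpha>" for \<alpha> by (simp add: equiv_mod_def)
  have asym: "\<not> below r \<beta> \<alpha>" if "below r \<alpha> \<beta>" for \<alpha> \<beta>
    using that lin by (auto simp: below_def linear_order_on_def partial_order_on_def dest: antisymD)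
  have mono: "below r \<alpha>' \<beta>'"
    if "\<alpha> \<in> Sen L (univ M)" "\<beta> \<in> Sen L (univ M)" "\<alpha>' \<in> Sen L (univ M)" "\<beta>' \<in> Sen L (univ M)"
      "\<not> ?E \<alpha> \<beta>" "below r \<alpha> \<beta>" "?E \<alpha>' \<alpha>" "?E \<beta>' \<beta>" for \<alpha> \<beta> \<alpha>' \<beta>'
    using reg that unfolding regular_order_def by blast
  have "?E (f (Upair \<alpha> \<beta>)) (f (Upair \<alpha>' \<beta>))"
    if Sen: "\<alpha> \<in> Sen L (univ M)" "\<alpha>' \<in> Sen L (univ M)" "\<beta> \<in> Sen L (univ M)" and eq: "?E \<alpha> \<alpha>'"
    for \<alpha> \<alpha>' \<beta>
  proof (cases "?E \<alpha> \<beta>")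
    case True
    then have "?E \<alpha>' \<beta>" using eq by (blast intro: equiv_mod_sym equiv_mod_trans)
    with True eq show ?thesis
      using f[OF Sen(1,3)] f[OF Sen(2,3)] refl by (auto intro: equiv_mod_sym)
  next
    case False
    then have "\<alpha> \<noteq> \<beta>" using refl by auto
    then consider "below r \<alpha> \<beta>" | "below r \<beta> \<alpha>"
      using lin Sen by (auto simp: below_def linear_order_on_def total_on_def)
    then show ?thesis
    proof cases
      case 1
      then have "below r \<alpha>' \<beta>"
        using mono[OF Sen(1,3,2,3) False] eq refl by (blast intro: equiv_mod_sym)
      with 1 eq show ?thesis using f[OF Sen(1,3)] f[OF Sen(2,3)] by simp
    next
      case 2
      moreover have "\<not> ?E \<beta> \<alpha>" using False by (blast intro: equiv_mod_sym)
      ultimately have "below r \<beta> \<alpha>'"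
        using mono[OF Sen(3,1,3,2)] eq refl by (blast intro: equiv_mod_sym)
      with 2 have "\<not> below r \<alpha> \<beta>" "\<not> below r \<alpha>' \<beta>" using asym by blast+
      then show ?thesis using f[OF Sen(1,3)] f[OF Sen(2,3)] refl by simp
    qed
  qed
  then have "regular L M f" unfolding regular_def by blast
  moreover have "associative L M f"
    unfolding associative_def
  proof (intro ballI)
    fix \<alpha> \<beta> \<gamma>
    assume Sen: "\<alpha> \<in> Sen L (univ M)" "\<beta> \<in> Sen L (univ M)" "\<gamma> \<in> Sen L (univ M)"
    have irrefl: "\<not> below r a a" for a by (simp add: below_def)
    have trans: "below r a c" if "below r a b" "below r b c" for a b c
    proof -
      from lin have "trans r" "antisym r"
        by (simp_all add: linear_order_on_def partial_order_on_def preorder_on_def)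
      with that show ?thesis unfolding below_def by (metis transD antisymD)
    qed
    have total: "a = b \<or> below r a b \<or> below r b a"
      if "a \<in> Sen L (univ M)" "b \<in> Sen L (univ M)" for a b
      using that lin by (auto simp: below_def linear_order_on_def total_on_def)
    show "f (Upair (f (Upair \<alpha> \<beta>)) \<gamma>) = f (Upair \<alpha> (f (Upair \<beta> \<gamma>)))"
      \<comment> \<open>All outcomes of the three pairwise comparisons are run through;
        \<open>asym\<close> and \<open>trans\<close> discard the cyclic ones.\<close>
      using total[OF Sen(1,2)] total[OF Sen(2,3)] total[OF Sen(1,3)]
      by (elim disjE) (auto simp: f Sen irrefl dest: asym trans)
  qed
  ultimately show "(M, f) \<in> Reg_star L" using S by (simp add: Reg_star_def Reg_def)
qed

section \<open>Soundness of the three concrete systems\<close>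

lemma RFOLS_sound_Reg:
  assumes "X \<subseteq> Reg L" "Rules S = {MP, GR, SV L}"
    and "\<And>M f \<phi>. (M, f) \<in> X \<Longrightarrow> \<phi> \<in> Ax S \<Longrightarrow> holds M f \<phi>"
  shows "RFOLS_sound L X S"
proof -
  have "Ax S \<inter> Restricted L {} \<subseteq> Taut L X"
    using assms(3) by (auto simp: Taut_def entails_def)
  then show ?thesis using sound_Reg[OF assms(1) _ assms(2)] by (simp add: RFOLS_sound_def)
qed

theorem theorem5p5:
  fixes L :: "('f, 'p) lang"
  shows
    "(\<forall>(X :: ('f, 'p, 'a) choice_class) (S :: ('f, 'p, 'a) formal_system).
        X \<subseteq> Reg L \<and> Ax S \<subseteq> Taut L X \<and> Rules S = {MP, GR, SV L} \<longrightarrow> RFOLS_sound L X S) \<and>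
     ((\<forall>c. (c, 0) \<notin> funs L) \<longrightarrow>
        RFOLS_sound L (Reg L :: ('f, 'p, 'a) choice_class) (Lambda1 L) \<and>
        RFOLS_sound L (Reg_star L :: ('f, 'p, 'a) choice_class) (Lambda2 L) \<and>
        RFOLS_sound L (Dec L :: ('f, 'p, 'a) choice_class) (Lambda3 L)) \<and>
     RFOLS_sound L (Reg L \<inter> Coh L :: ('f, 'p, 'a) choice_class) (Lambda1 L) \<and>
     RFOLS_sound L (Reg_star L \<inter> Coh L :: ('f, 'p, 'a) choice_class) (Lambda2 L) \<and>
     RFOLS_sound L (Dec L \<inter> Coh L :: ('f, 'p, 'a) choice_class) (Lambda3 L)"
proof -
  have general: "RFOLS_sound L X S"
    if "X \<subseteq> Reg L \<and> Ax S \<subseteq> Taut L X \<and> Rules S = {MP, GR, SV L}"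
    for X :: "('f, 'p, 'a) choice_class" and S
    using that sound_Reg[of X L S] by (auto simp: RFOLS_sound_def)
  have star: "(Reg_star L :: ('f, 'p, 'a) choice_class) \<subseteq> Reg L" by (auto simp: Reg_star_def)
  have 1: "RFOLS_sound L (Reg L \<inter> Coh L :: ('f, 'p, 'a) choice_class) (Lambda1 L)"
    by (rule RFOLS_sound_Reg) (auto simp: Lambda1_def intro: holds_Lambda0_axioms)
  have 2: "RFOLS_sound L (Reg_star L \<inter> Coh L :: ('f, 'p, 'a) choice_class) (Lambda2 L)"
    by (rule RFOLS_sound_Reg)
      (use star in \<open>auto simp: Lambda2_def Lambda1_def intro: holds_Lambda0_axioms holds_S4\<close>)
  have 3: "RFOLS_sound L (Dec L \<inter> Coh L :: ('f, 'p, 'a) choice_class) (Lambda3 L)"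
    by (rule RFOLS_sound_Reg) (use star Dec_subset_Reg_star in \<open>auto simp: Lambda3_def Lambda2_def
      Lambda1_def intro: holds_Lambda0_axioms holds_S4 holds_S5\<close>)
  have "RFOLS_sound L (Reg L :: ('f, 'p, 'a) choice_class) (Lambda1 L) \<and>
      RFOLS_sound L (Reg_star L :: ('f, 'p, 'a) choice_class) (Lambda2 L) \<and>
      RFOLS_sound L (Dec L :: ('f, 'p, 'a) choice_class) (Lambda3 L)"
    if "\<forall>c. (c, 0) \<notin> funs L"
  proof -
    have coh: "(Reg L :: ('f, 'p, 'a) choice_class) \<subseteq> Coh L"
      using that by (rule Reg_subset_Coh)
    \<comment> \<open>Without constants there are no closed terms of \<open>L\<close>, so regularity
      gives coherence and intersecting with \<open>Coh L\<close> changes none of the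
      classes.\<close>
    then have "Reg L \<inter> Coh L = (Reg L :: ('f, 'p, 'a) choice_class)"
      "Reg_star L \<inter> Coh L = (Reg_star L :: ('f, 'p, 'a) choice_class)"
      "Dec L \<inter> Coh L = (Dec L :: ('f, 'p, 'a) choice_class)"
      using star Dec_subset_Reg_star by blast+
    with 1 2 3 show ?thesis by simp
  qed
  with general 1 2 3 show ?thesis by blast
qed

end
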